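(* Let $m \ge 2$. For $\mathbf{s} = (\mathbf{s}_1,\ldots,\mathbf{s}_m) \in \mathbb{R}^{U\times m}$ (each $\mathbf{s}_i \in \mathbb{R}^U$) define $$\Pi(\mathbf{s}) = \Lambda(\mathbf{s}_1) - \sum_{i=2}^m \Lambda(\mathbf{s}_i)\,\Lambda(\mathbf{s}_1)^{-1}\,\Lambda(\mathbf{s}_i) \in \mathbb{S}^L$$ whenever $\Lambda(\mathbf{s}_1)$ is invertible, and let $$K^\ast_{\ell_2} = \operatorname{cl}\{\mathbf{s} \in \mathbb{R}^{U\times m} : \Lambda(\mathbf{s}_1) \succ 0,\ \Pi(\mathbf{s}) \succ 0\}.$$ Then the function $F(\mathbf{s}) = -\log\det \Pi(\mathbf{s}) - \log\det \Lambda(\mathbf{s}_1)$, defined on $\{\mathbf{s} : \Lambda(\mathbf{s}_1)\succ 0,\ \Pi(\mathbf{s})\succ 0\}$ (the interior of $K^\ast_{\ell_2}$), is a $2L$-logarithmically homogeneous self-concordant barrier for $K^\ast_{\ell_2}$.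
   Context: Fix integers $n,d\ge 1$, and set $L=\binom{n+d}{n}$, $U=\binom{n+2d}{n}$. Let $\mathbf{t}_1,\ldots,\mathbf{t}_U\in\mathbb{R}^n$ be points that are unisolvent for $\mathbb{R}[\mathbf{x}]_{n,2d}$ (the polynomials in $n$ variables of degree at most $2d$), i.e. a polynomial of degree at most $2d$ vanishing at all of them is zero, and let $p_1,\ldots,p_L$ be a basis of $\mathbb{R}[\mathbf{x}]_{n,d}$. Let $\mathbf{P}\in\mathbb{R}^{U\times L}$ with $P_{u,\ell}=p_\ell(\mathbf{t}_u)$, and define the linear map $\Lambda:\mathbb{R}^U\to\mathbb{S}^L$ by $\Lambda(\mathbf{s})=\mathbf{P}^\top\operatorname{Diag}(\mathbf{s})\mathbf{P}$, where $\mathbb{S}^L$ denotes the real symmetric $L\times L$ matrices. A function $F$ on the interior of a closed convex cone $K$ with nonempty interior is a $\nu$-logarithmically homogeneous self-concordant barrier ($\nu$-LHSCB) if it is $C^3$ and convex, $F(\mathbf{x}_k)\to\infty$ whenever $\mathbf{x}_k$ converges to a point on the boundary of $K$, $|D^3F(\mathbf{x})[\mathbf{h},\mathbf{h},\mathbf{h}]|\le 2\,(D^2F(\mathbf{x})[\mathbf{h},\mathbf{h}])^{3/2}$ for all interior $\mathbf{x}$ and all directions $\mathbf{h}$, and $F(\tau\mathbf{x})=F(\mathbf{x})-\nu\log\tau$ for all $\tau>0$. *)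

theory Defs
  imports "HOL-Analysis.Analysis"
begin

definition multi_indices :: "nat \<Rightarrow> ('n::finite \<Rightarrow> nat) set" where
  "multi_indices k = {\<alpha>. (\<Sum>i\<in>UNIV. \<alpha> i) \<le> k}"

definition monomial :: "('n::finite \<Rightarrow> nat) \<Rightarrow> real^'n \<Rightarrow> real" where
  "monomial \<alpha> x = (\<Prod>i\<in>UNIV. (x $ i) ^ (\<alpha> i))"

definition poly_funs :: "nat \<Rightarrow> (real^'n::finite \<Rightarrow> real) set" where
  "poly_funs k = {f. \<exists>c :: ('n \<Rightarrow> nat) \<Rightarrow> real.
      f = (\<lambda>x. \<Sum>\<alpha>\<in>multi_indices k. c \<alpha> * monomial \<alpha> x)}"

definition is_basis_of :: "('l::finite \<Rightarrow> (real^'n::finite \<Rightarrow> real)) \<Rightarrow> nat \<Rightarrow> bool" where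
  "is_basis_of p k \<longleftrightarrow> (\<forall>l. p l \<in> poly_funs k) \<and>
     (\<forall>f \<in> poly_funs k. \<exists>!c :: 'l \<Rightarrow> real. f = (\<lambda>x. \<Sum>l\<in>UNIV. c l * p l x))"

definition unisolvent :: "('u::finite \<Rightarrow> real^'n::finite) \<Rightarrow> nat \<Rightarrow> bool" where
  "unisolvent t k \<longleftrightarrow> (\<forall>f \<in> poly_funs k. (\<forall>u. f (t u) = 0) \<longrightarrow> f = (\<lambda>_. 0))"

text \<open>Lambda(s) = P^T Diag(s) P with P(u,l) = p_l(t_u).\<close>
definition Lam :: "('l::finite \<Rightarrow> (real^'n::finite \<Rightarrow> real)) \<Rightarrow> ('u::finite \<Rightarrow> real^'n)
                   \<Rightarrow> real^'u \<Rightarrow> real^'l^'l" where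
  "Lam p t s = (\<chi> i j. \<Sum>u\<in>UNIV. p i (t u) * (s $ u) * p j (t u))"

definition pos_def :: "real^'l^'l \<Rightarrow> bool" where
  "pos_def A \<longleftrightarrow> transpose A = A \<and> (\<forall>x. x \<noteq> 0 \<longrightarrow> x \<bullet> (A *v x) > 0)"

text \<open>The point s = (s_1, ..., s_m) is represented as a pair (s_1, r) with r $ k = s_{k}
  for k ranging over a finite type of cardinality m - 1.\<close>
definition Pi_map :: "('l::finite \<Rightarrow> (real^'n::finite \<Rightarrow> real)) \<Rightarrow> ('u::finite \<Rightarrow> real^'n)
                   \<Rightarrow> (real^'u) \<times> (real^'u^'k::finite) \<Rightarrow> real^'l^'l" where
  "Pi_map p t s = Lam p t (fst s) -
     (\<Sum>k\<in>UNIV. Lam p t (snd s $ k) ** matrix_inv (Lam p t (fst s)) ** Lam p t (snd s $ k))"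

definition LHSCB :: "('a::euclidean_space) set \<Rightarrow> ('a \<Rightarrow> real) \<Rightarrow> real \<Rightarrow> bool" where
  "LHSCB K F \<nu> \<longleftrightarrow>
     closed K \<and> convex K \<and> cone K \<and> interior K \<noteq> {} \<and>
     convex_on (interior K) F \<and>
     (\<exists>(D1 :: 'a \<Rightarrow> 'a \<Rightarrow>\<^sub>L real) (D2 :: 'a \<Rightarrow> 'a \<Rightarrow>\<^sub>L 'a \<Rightarrow>\<^sub>L real)
        (D3 :: 'a \<Rightarrow> 'a \<Rightarrow>\<^sub>L 'a \<Rightarrow>\<^sub>L 'a \<Rightarrow>\<^sub>L real).
        (\<forall>x\<in>interior K.
           (F has_derivative blinfun_apply (D1 x)) (at x) \<and>
           (D1 has_derivative blinfun_apply (D2 x)) (at x) \<and>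
           (D2 has_derivative blinfun_apply (D3 x)) (at x)) \<and>
        continuous_on (interior K) D3 \<and>
        (\<forall>x\<in>interior K. \<forall>h.
           \<bar>D3 x h h h\<bar> \<le> 2 * (D2 x h h) powr (3/2))) \<and>
     (\<forall>X x. (\<forall>j. X j \<in> interior K) \<longrightarrow> X \<longlonglongrightarrow> x \<longrightarrow> x \<in> frontier K \<longrightarrow>
         filterlim (\<lambda>j. F (X j)) at_top sequentially) \<and>
     (\<forall>x\<in>interior K. \<forall>\<tau>>0. F (\<tau> *\<^sub>R x) = F x - \<nu> * ln \<tau>)"

end

theory Submission
  imports Defs
begin

text \<open>
  Write \<open>Y = \<Lambda>(s\<^sub>1)\<close>, \<open>B\<^sub>i = \<Lambda>(s\<^sub>i)\<close>, \<open>J = Y\<^sup>-\<^sup>1\<close>, \<open>G = \<Pi>(s)\<close>, and let \<open>H\<close>, \<open>C\<^sub>i\<close> be the images of a direction.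
  With \<open>W\<^sub>i = C\<^sub>i - H J B\<^sub>i\<close> one finds \<open>G'' = - 2 \<Sum> W\<^sub>i\<^sup>T J W\<^sub>i\<close> and \<open>G''' = 6 \<Sum> W\<^sub>i\<^sup>T J H J W\<^sub>i\<close> along the line.
  Factor \<open>J = T T\<^sup>T\<close> and \<open>G\<^sup>-\<^sup>1 = R R\<^sup>T\<close>, and put \<open>A = R\<^sup>T G' R\<close>, \<open>M = T\<^sup>T H T\<close>, \<open>V\<^sub>i = T\<^sup>T W\<^sub>i R\<close>. With the
  Frobenius norms \<open>a = |A|\<close>, \<open>h = |M|\<close>, \<open>q\<^sup>2 = \<Sum> |V\<^sub>i|\<^sup>2\<close>, the second derivative of the barrier is
  \<open>a\<^sup>2 + h\<^sup>2 + 2 q\<^sup>2\<close> and the third is at most \<open>2 (a\<^sup>3 + h\<^sup>3 + 3 (a + h) q\<^sup>2)\<close> in absolute value. These are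
  \<open>tr N\<^sup>2\<close> and \<open>2 tr N\<^sup>3\<close> for the symmetric \<open>2 \<times> 2\<close> matrix \<open>N\<close> with diagonal \<open>a, h\<close> and off-diagonal entry
  \<open>q\<close>, and \<open>|tr N\<^sup>3| \<le> (tr N\<^sup>2)\<^sup>3\<^sup>/\<^sup>2\<close>.

  The domain is an open convex cone because, by completing squares, it is the set where the block
  arrow form \<open>x \<bullet> Y x - 2 \<Sum> w\<^sub>i \<bullet> B\<^sub>i x + \<Sum> w\<^sub>i \<bullet> Y w\<^sub>i\<close>, which is linear in \<open>s\<close>, is positive for all
  \<open>x \<noteq> 0\<close> and all \<open>w\<close>. At a boundary point \<open>det \<Pi>(s) det Y\<close> tends to \<open>0\<close>, since \<open>\<Pi>(s)\<close> stays bounded by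
  \<open>tr Y\<close>.
\<close>

section \<open>Frobenius inner product, norm and trace of matrices\<close>

lemma inner_matrix_eq_trace: "(A :: real^'n^'m) \<bullet> B = trace (transpose A ** B)"
  unfolding inner_vec_def trace_def matrix_matrix_mult_def transpose_def
  by simp (rule sum.swap)

text \<open>The norm of \<open>real^'n^'m\<close> is the Frobenius norm. Each entry of the product
  is a row times a column, so Cauchy-Schwarz for every entry and summation give
  submultiplicativity.\<close>

lemma norm_matrix_mult_le:
  fixes A :: "real^'n^'m" and B :: "real^'p^'n"
  shows "norm (A ** B) \<le> norm A * norm B"
proof -
  have nB: "(\<Sum>j\<in>UNIV. column j B \<bullet> column j B) = B \<bullet> B"
    unfolding inner_vec_def column_def by simp (rule sum.swap)
  have "(A ** B) \<bullet> (A ** B) = (\<Sum>i\<in>UNIV. \<Sum>j\<in>UNIV. (A $ i \<bullet> column j B)\<^sup>2)"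
    unfolding inner_vec_def matrix_matrix_mult_def column_def by (simp add: power2_eq_square)
  also have "\<dots> \<le> (\<Sum>i\<in>UNIV. \<Sum>j\<in>UNIV. (A $ i \<bullet> A $ i) * (column j B \<bullet> column j B))"
    by (intro sum_mono Cauchy_Schwarz_ineq)
  also have "\<dots> = (A \<bullet> A) * (B \<bullet> B)"
    unfolding sum_distrib_left[symmetric] sum_distrib_right[symmetric] nB
    by (simp add: inner_vec_def[of A A])
  finally have "(norm (A ** B))\<^sup>2 \<le> (norm A * norm B)\<^sup>2"
    by (simp add: power2_norm_eq_inner power_mult_distrib)
  then show ?thesis
    by (rule power2_le_imp_le) simp
qed

lemma matrix_mult_scaleR_left: "(c *\<^sub>R A) ** B = c *\<^sub>R (A ** (B :: real^'p^'n))"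
  by (simp add: matrix_matrix_mult_def vec_eq_iff sum_distrib_left mult_ac)

lemma matrix_mult_scaleR_right: "A ** (c *\<^sub>R B) = c *\<^sub>R (A ** (B :: real^'p^'n))"
  by (simp add: matrix_matrix_mult_def vec_eq_iff sum_distrib_left mult_ac)

lemma matrix_add_rdistrib: "(A + B) ** C = A ** C + B ** (C :: real^'p^'n)"
  by (simp add: matrix_matrix_mult_def vec_eq_iff sum.distrib distrib_right)

lemma norm_matrix_vector_mult_le:
  fixes A :: "real^'n^'m"
  shows "norm (A *v x) \<le> norm A * norm x"
proof -
  have "(A *v x) \<bullet> (A *v x) = (\<Sum>i\<in>UNIV. (A $ i \<bullet> x)\<^sup>2)"
    by (simp add: inner_vec_def[of "A *v x"] matrix_vector_mul_component power2_eq_square)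
  also have "\<dots> \<le> (\<Sum>i\<in>UNIV. (A $ i \<bullet> A $ i) * (x \<bullet> x))"
    by (intro sum_mono Cauchy_Schwarz_ineq)
  also have "\<dots> = (A \<bullet> A) * (x \<bullet> x)"
    by (simp add: inner_vec_def[of A A] sum_distrib_right)
  finally have "(norm (A *v x))\<^sup>2 \<le> (norm A * norm x)\<^sup>2"
    by (simp add: power2_norm_eq_inner power_mult_distrib)
  then show ?thesis
    by (rule power2_le_imp_le) simp
qed

text \<open>Supplies the noncommutative product rule, limits and distribution over sums for the
  matrix product, on which the derivative computations below rest.\<close>

interpretation matrix_mult: bounded_bilinear "(**) :: real^'n^'m \<Rightarrow> real^'p^'n \<Rightarrow> real^'p^'m"
proof
  show "\<exists>K. \<forall>(a :: real^'n^'m) (b :: real^'p^'n). norm (a ** b) \<le> norm a * norm b * K"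
    by (intro exI[of _ 1]) (simp add: norm_matrix_mult_le)
qed (simp_all only: matrix_add_ldistrib matrix_add_rdistrib matrix_mult_scaleR_left matrix_mult_scaleR_right)

lemma bounded_linear_transpose: "bounded_linear (transpose :: real^'n^'m \<Rightarrow> real^'m^'n)"
  by (rule linear_conv_bounded_linear[THEN iffD1], rule linearI) (simp_all add: transpose_def vec_eq_iff)

lemmas transpose_add = linear_add[OF bounded_linear.linear[OF bounded_linear_transpose]]
  and transpose_diff = linear_diff[OF bounded_linear.linear[OF bounded_linear_transpose]]
  and transpose_sum = linear_sum[OF bounded_linear.linear[OF bounded_linear_transpose]]

lemma bounded_linear_trace: "bounded_linear (trace :: real^'n^'n \<Rightarrow> real)"
  by (rule linear_conv_bounded_linear[THEN iffD1], rule linearI)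
    (simp_all add: trace_def sum.distrib sum_distrib_left)

lemmas trace_add = linear_add[OF bounded_linear.linear[OF bounded_linear_trace]]
  and trace_diff = linear_diff[OF bounded_linear.linear[OF bounded_linear_trace]]
  and trace_minus = linear_neg[OF bounded_linear.linear[OF bounded_linear_trace]]
  and trace_scaleR = linear_scale[OF bounded_linear.linear[OF bounded_linear_trace]]
  and trace_sum = linear_sum[OF bounded_linear.linear[OF bounded_linear_trace]]

lemma norm_transpose: "norm (transpose A) = norm (A :: real^'n^'m)"
  using trace_mul_sym[of A "transpose A"] by (simp add: norm_eq_sqrt_inner inner_matrix_eq_trace)

lemma abs_trace_mult_le: "\<bar>trace ((A :: real^'n^'m) ** B)\<bar> \<le> norm A * norm B"
proof -
  have "trace (A ** B) = transpose A \<bullet> B"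
    by (simp add: inner_matrix_eq_trace)
  then show ?thesis
    using Cauchy_Schwarz_ineq2[of "transpose A" B] by (simp add: norm_transpose)
qed

section \<open>Inverses and determinants\<close>

lemma matrix_inv_mult:
  fixes A :: "real^'n^'n"
  assumes "invertible A"
  shows "matrix_inv A ** A = mat 1" "A ** matrix_inv A = mat 1"
  using assms unfolding invertible_def matrix_inv_def by (metis (mono_tags, lifting) someI_ex)+

lemma matrix_inv_unique:
  fixes A :: "real^'n^'n"
  assumes "A ** B = mat 1"
  shows "matrix_inv A = B"
proof -
  have "invertible A"
    using assms invertible_right_inverse by blast
  then show ?thesis
    by (metis assms matrix_inv_mult(1) matrix_mul_assoc matrix_mul_lid matrix_mul_rid)
qed

text \<open>Cramer's rule for the right-hand side \<open>axis l 1\<close>. Entries written as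
  quotients of determinants make the inverse continuous and smooth wherever the determinant is
  nonzero.\<close>

lemma matrix_inv_nth:
  fixes A :: "real^'n^'n"
  assumes "det A \<noteq> 0"
  shows "matrix_inv A $ k $ l = det (\<chi> i j. if j = k then (if i = l then 1 else 0) else A $ i $ j) / det A"
proof -
  define b :: "real^'n" where "b = axis l 1"
  have b: "b $ i = (if i = l then 1 else 0)" for i
    by (auto simp: b_def axis_def)
  have "A *v (matrix_inv A *v b) = b"
    using assms by (simp add: matrix_vector_mul_assoc matrix_inv_mult invertible_det_nz)
  then have "matrix_inv A *v b = (\<chi> k. det (\<chi> i j. if j = k then b $ i else A $ i $ j) / det A)"
    using cramer[OF assms] by blast
  then have "(matrix_inv A *v b) $ k = det (\<chi> i j. if j = k then b $ i else A $ i $ j) / det A"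
    by simp
  moreover have "(matrix_inv A *v b) $ k = matrix_inv A $ k $ l"
    by (simp add: b_def matrix_vector_mul_component inner_axis)
  ultimately show ?thesis
    by (simp only: b)
qed

lemma det_scaleR: "det (c *\<^sub>R (A :: real^'n^'n)) = c ^ CARD('n) * det A"
proof -
  have "c *\<^sub>R A = matrix ((*\<^sub>R) c) ** A"
    by (simp add: matrix_scaleR matrix_mult_scaleR_left mat_def matrix_matrix_mult_def vec_eq_iff
        if_distrib[of "\<lambda>x. x * _"] cong: if_cong)
  then show ?thesis
    by (simp add: det_mul)
qed

lemma inner_transpose_matrix: "x \<bullet> ((A :: real^'n^'m) *v y) = (transpose A *v x) \<bullet> y"
  by (simp add: dot_lmul_matrix)

section \<open>Positive definite matrices\<close>

lemma pos_def_transpose: "pos_def A \<Longrightarrow> transpose A = A"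
  by (simp add: pos_def_def)

lemma pos_def_det_nz: "pos_def (A :: real^'n^'n) \<Longrightarrow> det A \<noteq> 0"
  unfolding pos_def_def invertible_det_nz[symmetric]
  by (metis inner_zero_right less_irrefl invertible_left_inverse matrix_left_invertible_ker)

text \<open>Gram-Schmidt for the inner product \<open>x \<bullet> (A *v y)\<close>: a family
  orthonormal for it is extended one index at a time, and the final family forms the columns of
  \<open>R\<close>.\<close>

lemma pos_def_congruent_identity:
  fixes A :: "real^'n^'n"
  assumes "pos_def A"
  obtains R :: "real^'n^'n" where "transpose R ** A ** R = mat 1"
proof -
  have "\<exists>v :: 'n \<Rightarrow> real^'n. \<forall>i\<in>I. \<forall>j\<in>I. v i \<bullet> (A *v v j) = (if i = j then 1 else 0)" for I
  proof (induction I rule: finite_induct[OF finite])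
    case (2 a I)
    then obtain v where v: "\<forall>i\<in>I. \<forall>j\<in>I. v i \<bullet> (A *v v j) = (if i = j then 1 else 0)"
      by blast
    \<comment> \<open>The vectors \<open>A *v v i\<close> found so far span a proper subspace, so
      some nonzero \<open>w\<close> is orthogonal to all of them; normalized in the form of
      \<open>A\<close>, it becomes the new member.\<close>
    have "dim ((\<lambda>i. A *v v i) ` I) \<le> card I"
      by (meson card_image_le dim_le_card' finite finite_imageI le_trans)
    also have "card I < CARD('n)"
      using 2 by (metis UNIV_I finite psubsetI psubset_card_mono subset_UNIV)
    finally have "dim ((\<lambda>i. A *v v i) ` I) < DIM(real^'n)"
      by simp
    then obtain w where w: "w \<noteq> 0" "\<And>y. y \<in> span ((\<lambda>i. A *v v i) ` I) \<Longrightarrow> orthogonal w y"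
      using orthogonal_to_subspace_exists by blast
    have wv: "w \<bullet> (A *v v i) = 0" "v i \<bullet> (A *v w) = 0" if "i \<in> I" for i
    proof -
      show "w \<bullet> (A *v v i) = 0"
        using w(2)[of "A *v v i"] that by (auto simp: orthogonal_def span_base)
      then show "v i \<bullet> (A *v w) = 0"
        using pos_def_transpose[OF assms] by (metis inner_commute inner_transpose_matrix)
    qed
    define c where "c = w \<bullet> (A *v w)"
    have c: "c > 0"
      using assms w(1) by (auto simp: pos_def_def c_def)
    define u where "u = v(a := (1 / sqrt c) *\<^sub>R w)"
    have "u i \<bullet> (A *v u j) = (if i = j then 1 else 0)" if "i \<in> insert a I" "j \<in> insert a I" for i j
    proof -
      have "(1 / sqrt c) * (1 / sqrt c) * c = 1"
        using c by (simp add: field_simps)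
      then have "u a \<bullet> (A *v u a) = 1"
        by (simp add: u_def matrix_vector_mult_scaleR mult.assoc flip: c_def)
      moreover have "u a \<bullet> (A *v u j) = 0" "u j \<bullet> (A *v u a) = 0" "u j = v j" if "j \<in> I" for j
        using that wv \<open>a \<notin> I\<close> by (auto simp: u_def matrix_vector_mult_scaleR)
      ultimately show ?thesis
        using that v by (cases "i = a"; cases "j = a") auto
    qed
    then show ?case by blast
  qed simp
  from this[of UNIV] obtain v :: "'n \<Rightarrow> real^'n"
    where v: "\<And>i j. v i \<bullet> (A *v v j) = (if i = j then 1 else 0)" by auto
  define R :: "real^'n^'n" where "R = (\<chi> i j. v j $ i)"
  have col: "column j (A ** R) = A *v v j" for j
    by (simp add: column_def vec_eq_iff R_def matrix_matrix_mult_def matrix_vector_mult_def)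
  have "(transpose R ** (A ** R)) $ i $ j = v i \<bullet> column j (A ** R)" for i j
    by (subst matrix_matrix_mult_def) (simp add: transpose_def R_def inner_vec_def column_def)
  then have "transpose R ** (A ** R) = mat 1"
    by (simp add: vec_eq_iff col v mat_def)
  then show thesis
    using that by (simp add: matrix_mul_assoc)
qed

lemma pos_def_inverse_factor:
  fixes A :: "real^'n^'n"
  assumes "pos_def A"
  obtains R :: "real^'n^'n" where "matrix_inv A = R ** transpose R"
proof -
  obtain R :: "real^'n^'n" where R: "transpose R ** A ** R = mat 1"
    using pos_def_congruent_identity[OF assms] .
  then have "R ** (transpose R ** A) = mat 1"
    using matrix_left_right_inverse[of R] by blast
  then have "A ** (R ** transpose R) = mat 1"
    by (metis matrix_left_right_inverse matrix_mul_assoc)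
  then show thesis
    using that matrix_inv_unique by blast
qed

lemma pos_def_factor:
  fixes A :: "real^'n^'n"
  assumes "pos_def A"
  obtains Q :: "real^'n^'n" where "A = transpose Q ** Q"
proof -
  obtain R :: "real^'n^'n" where R: "transpose R ** A ** R = mat 1"
    using pos_def_congruent_identity[OF assms] .
  define Q where "Q = transpose R ** A"
  have "R ** Q = mat 1" "Q ** R = mat 1"
    using R matrix_left_right_inverse[of R "transpose R ** A"] unfolding Q_def by blast+
  then have "transpose Q ** transpose R = mat 1"
    by (metis matrix_transpose_mul transpose_mat)
  then have "A = transpose Q ** Q"
    unfolding Q_def by (metis matrix_mul_assoc matrix_mul_lid)
  then show thesis
    using that by blast
qed

lemma pos_def_det_pos:
  fixes A :: "real^'n^'n"
  assumes "pos_def A"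
  shows "det A > 0"
proof -
  obtain Q :: "real^'n^'n" where "A = transpose Q ** Q"
    using pos_def_factor[OF assms] .
  then have "det A = (det Q)\<^sup>2"
    by (simp add: det_mul power2_eq_square)
  then show ?thesis
    using pos_def_det_nz[OF assms] by (metis zero_less_power2 zero_power2)
qed

text \<open>With \<open>A = transpose Q ** Q\<close> the trace is the squared Frobenius norm of
  \<open>Q\<close>, which bounds \<open>norm A\<close> by submultiplicativity.\<close>

lemma pos_def_norm_le_trace:
  fixes A :: "real^'n^'n"
  assumes "pos_def A"
  shows "norm A \<le> trace A"
proof -
  obtain Q :: "real^'n^'n" where Q: "A = transpose Q ** Q"
    using pos_def_factor[OF assms] .
  then have "norm A \<le> norm Q * norm Q"
    using norm_matrix_mult_le[of "transpose Q" Q] by (simp add: norm_transpose)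
  also have "\<dots> = trace A"
    by (simp add: Q inner_matrix_eq_trace[symmetric] power2_norm_eq_inner flip: power2_eq_square)
  finally show ?thesis .
qed

lemma transpose_matrix_inv:
  fixes A :: "real^'n^'n"
  assumes "invertible A" "transpose A = A"
  shows "transpose (matrix_inv A) = matrix_inv A"
proof -
  have "transpose (matrix_inv A ** A) = mat 1"
    using assms by (simp add: matrix_inv_mult transpose_mat)
  then have "A ** transpose (matrix_inv A) = mat 1"
    using assms by (simp add: matrix_transpose_mul)
  then show ?thesis
    using matrix_inv_unique by metis
qed

text \<open>If \<open>y = A *v x\<close> were nonzero, a short move from \<open>x\<close> along
  \<open>- y\<close> would make the form negative: it changes by
  \<open>- 2 * e * (y \<bullet> y) + e\<^sup>2 * c\<close>, where the linear term dominates for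
  small \<open>e\<close>.\<close>

lemma semidefinite_kernel:
  fixes A :: "real^'n^'n"
  assumes "transpose A = A" "\<And>x. 0 \<le> x \<bullet> (A *v x)" "x \<bullet> (A *v x) = 0"
  shows "A *v x = 0"
proof (rule ccontr)
  define y where "y = A *v x"
  assume "A *v x \<noteq> 0"
  then have y: "y \<bullet> y > 0" by (simp add: y_def)
  define c where "c = y \<bullet> (A *v y)"
  have c: "c \<ge> 0" using assms(2) by (simp add: c_def)
  \<comment> \<open>Small enough for \<open>e * c \<le> y \<bullet> y\<close>; the
    \<open>+ 1\<close> keeps the denominator positive when \<open>c = 0\<close>.\<close>
  define e where "e = (y \<bullet> y) / (c + 1)"
  have "x \<bullet> (A *v y) = y \<bullet> y"
    using assms(1) by (metis inner_transpose_matrix y_def)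
  then have "(x - e *\<^sub>R y) \<bullet> (A *v (x - e *\<^sub>R y)) = - 2 * e * (y \<bullet> y) + e\<^sup>2 * c"
    using assms(3) by (simp add: matrix_vector_mult_diff_distrib matrix_vector_mult_scaleR
        inner_diff_left inner_diff_right c_def power2_eq_square algebra_simps flip: y_def)
  moreover have "e\<^sup>2 * c < e * (y \<bullet> y) * 2"
  proof -
    have "e > 0" using y c by (simp add: e_def)
    have "e * c \<le> y \<bullet> y"
      using y c by (simp add: e_def field_simps)
    then have "e * c < 2 * (y \<bullet> y)" using y by linarith
    then show ?thesis using \<open>e > 0\<close> by (simp add: power2_eq_square)
  qed
  ultimately show False
    using assms(2)[of "x - e *\<^sub>R y"] by linarith
qed

text \<open>Meant for limits of positive definite matrices: these are semidefinite, and a loss of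
  definiteness shows up as a vanishing determinant.\<close>

lemma pos_def_iff_semidefinite_det:
  fixes A :: "real^'n^'n"
  assumes "transpose A = A" "\<And>x. 0 \<le> x \<bullet> (A *v x)"
  shows "pos_def A \<longleftrightarrow> det A \<noteq> 0"
proof
  assume "det A \<noteq> 0"
  then have "x = 0" if "x \<bullet> (A *v x) = 0" for x
    using semidefinite_kernel[OF assms that]
    by (metis invertible_det_nz invertible_left_inverse matrix_left_invertible_ker)
  then show "pos_def A"
    using assms unfolding pos_def_def by (metis less_eq_real_def)
qed (rule pos_def_det_nz)

text \<open>The radius is the minimum of the form over the unit sphere, positive by compactness. A
  symmetric perturbation of smaller Frobenius norm changes the form on the sphere by less than this
  minimum.\<close>

lemma pos_def_ball:
  fixes A :: "real^'n^'n"
  assumes "pos_def A"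
  obtains e where "e > 0" "\<And>B. transpose B = B \<Longrightarrow> dist B A < e \<Longrightarrow> pos_def B"
proof -
  have "continuous_on (sphere 0 1) (\<lambda>x. x \<bullet> (A *v x))"
    by (intro continuous_intros)
  moreover have "sphere (0 :: real^'n) 1 \<noteq> {}"
    by simp
  ultimately obtain z where z: "z \<in> sphere 0 1" "\<And>x. x \<in> sphere 0 1 \<Longrightarrow> z \<bullet> (A *v z) \<le> x \<bullet> (A *v x)"
    using continuous_attains_inf[OF compact_sphere] by blast
  define e where "e = z \<bullet> (A *v z)"
  have "e > 0"
    using assms z(1) unfolding e_def pos_def_def by (metis mem_sphere_0 norm_zero zero_neq_one)
  moreover have "pos_def B" if B: "transpose B = B" "dist B A < e" for B
    unfolding pos_def_def
  proof (intro conjI allI impI B(1))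
    fix x :: "real^'n" assume "x \<noteq> 0"
    define y where "y = x /\<^sub>R norm x"
    have ny: "norm y = 1" using \<open>x \<noteq> 0\<close> by (simp add: y_def)
    have "\<bar>y \<bullet> ((B - A) *v y)\<bar> \<le> norm y * norm ((B - A) *v y)"
      by (rule Cauchy_Schwarz_ineq2)
    also have "norm ((B - A) *v y) \<le> norm (B - A) * norm y"
      by (rule norm_matrix_vector_mult_le)
    finally have "\<bar>y \<bullet> ((B - A) *v y)\<bar> < e"
      using B(2) ny by (simp add: dist_norm)
    moreover have "e \<le> y \<bullet> (A *v y)"
      using z(2)[of y] ny by (simp add: e_def)
    moreover have "y \<bullet> ((B - A) *v y) = y \<bullet> (B *v y) - y \<bullet> (A *v y)"
      by (simp add: matrix_vector_mult_diff_rdistrib inner_diff_right)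
    ultimately have "0 < y \<bullet> (B *v y)" by linarith
    then show "0 < x \<bullet> (B *v x)"
      using \<open>x \<noteq> 0\<close> by (simp add: y_def matrix_vector_mult_scaleR zero_less_mult_iff)
  qed
  ultimately show thesis using that by blast
qed

section \<open>Continuously differentiable functions\<close>

text \<open>Recording gradients component by component keeps all functions real-valued, so that the
  order of differentiability can be an argument.\<close>

primrec C_diff :: "nat \<Rightarrow> 'a::euclidean_space set \<Rightarrow> ('a \<Rightarrow> real) \<Rightarrow> bool" where
  "C_diff 0 S f \<longleftrightarrow> continuous_on S f"
| "C_diff (Suc n) S f \<longleftrightarrow>
     (\<exists>g. (\<forall>x\<in>S. (f has_derivative (\<lambda>h. g x \<bullet> h)) (at x)) \<and> (\<forall>b\<in>Basis. C_diff n S (\<lambda>x. g x \<bullet> b)))"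

lemma C_diff_continuous_on: "C_diff n S f \<Longrightarrow> continuous_on S f"
  by (cases n) (auto simp: continuous_on_eq_continuous_within,
      meson has_derivative_at_withinI has_derivative_continuous)

lemma C_diff_Suc_imp: "C_diff (Suc n) S f \<Longrightarrow> C_diff n S f"
proof (induction n arbitrary: f)
  case 0
  then show ?case using C_diff_continuous_on[of "Suc 0"] by simp
next
  case (Suc n)
  then obtain g where "\<forall>x\<in>S. (f has_derivative (\<lambda>h. g x \<bullet> h)) (at x)"
      "\<forall>b\<in>Basis. C_diff (Suc n) S (\<lambda>x. g x \<bullet> b)"
    by (auto simp only: C_diff.simps)
  then show ?case
    using Suc.IH by (auto intro!: exI[of _ g])
qed

text \<open>Openness of \<open>S\<close> lets an equality on \<open>S\<close> transfer derivatives
  that are taken in the full space.\<close>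

lemma C_diff_cong:
  assumes "open S" "C_diff n S f" "\<And>x. x \<in> S \<Longrightarrow> f x = g x"
  shows "C_diff n S g"
proof (cases n)
  case 0
  then show ?thesis using assms by (metis C_diff.simps(1) continuous_on_cong)
next
  case (Suc m)
  then obtain f' where "\<forall>x\<in>S. (f has_derivative (\<lambda>h. f' x \<bullet> h)) (at x)"
      "\<forall>b\<in>Basis. C_diff m S (\<lambda>x. f' x \<bullet> b)"
    using assms(2) by auto
  moreover from this have "\<forall>x\<in>S. (g has_derivative (\<lambda>h. f' x \<bullet> h)) (at x)"
    using assms by (blast intro: has_derivative_transform_within_open)
  ultimately show ?thesis using Suc by auto
qed

lemma C_diff_const: "C_diff n S (\<lambda>x. c)"
  by (induction n arbitrary: c) (auto intro!: exI[of _ "\<lambda>x. 0"])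

lemma C_diff_linear:
  assumes "bounded_linear f"
  shows "C_diff n S f"
proof (cases n)
  case 0
  then show ?thesis
    using assms by (simp add: linear_continuous_on)
next
  case (Suc m)
  define g where "g = adjoint f 1"
  have "f h = g \<bullet> h" for h
    using adjoint_works[of f h 1] assms
    by (simp add: g_def bounded_linear.linear inner_commute)
  then have "f = (\<lambda>h. g \<bullet> h)" by auto
  then have "\<forall>x\<in>S. (f has_derivative (\<lambda>h. g \<bullet> h)) (at x)"
    using bounded_linear_imp_has_derivative[OF assms] by auto
  then show ?thesis
    using Suc by (auto intro!: exI[of _ "\<lambda>_. g"] C_diff_const)
qed

lemma C_diff_add:
  assumes "C_diff n S f" "C_diff n S g"
  shows "C_diff n S (\<lambda>x. f x + g x)"
  using assms
proof (induction n arbitrary: f g)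
  case 0
  then show ?case by (auto intro: continuous_on_add)
next
  case (Suc n)
  then obtain f' g' where
    d: "\<forall>x\<in>S. (f has_derivative (\<lambda>h. f' x \<bullet> h)) (at x)" "\<forall>b\<in>Basis. C_diff n S (\<lambda>x. f' x \<bullet> b)"
      "\<forall>x\<in>S. (g has_derivative (\<lambda>h. g' x \<bullet> h)) (at x)" "\<forall>b\<in>Basis. C_diff n S (\<lambda>x. g' x \<bullet> b)"
    by (auto simp only: C_diff.simps)
  have "((\<lambda>x. f x + g x) has_derivative (\<lambda>h. (f' x + g' x) \<bullet> h)) (at x)" if "x \<in> S" for x
    using has_derivative_add[OF d(1)[rule_format, OF that] d(3)[rule_format, OF that]]
    by (simp add: inner_add_left)
  moreover have "C_diff n S (\<lambda>x. (f' x + g' x) \<bullet> b)" if "b \<in> Basis" for b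
    using Suc.IH[of "\<lambda>x. f' x \<bullet> b" "\<lambda>x. g' x \<bullet> b"] d that by (simp add: inner_add_left)
  ultimately show ?case
    by (auto intro!: exI[of _ "\<lambda>x. f' x + g' x"])
qed

text \<open>The components of the gradient are again sums of products, in which \<open>f\<close> and
  \<open>g\<close> themselves appear one order lower by \<open>C_diff_Suc_imp\<close>; hence the
  induction over arbitrary factors.\<close>

lemma C_diff_mult:
  assumes "C_diff n S f" "C_diff n S g"
  shows "C_diff n S (\<lambda>x. f x * g x)"
  using assms
proof (induction n arbitrary: f g)
  case 0
  then show ?case by (auto intro: continuous_on_mult)
next
  case (Suc n)
  then obtain f' g' where
    d: "\<forall>x\<in>S. (f has_derivative (\<lambda>h. f' x \<bullet> h)) (at x)" "\<forall>b\<in>Basis. C_diff n S (\<lambda>x. f' x \<bullet> b)"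
      "\<forall>x\<in>S. (g has_derivative (\<lambda>h. g' x \<bullet> h)) (at x)" "\<forall>b\<in>Basis. C_diff n S (\<lambda>x. g' x \<bullet> b)"
    by (auto simp only: C_diff.simps)
  define D where "D x = f x *\<^sub>R g' x + g x *\<^sub>R f' x" for x
  have "((\<lambda>x. f x * g x) has_derivative (\<lambda>h. D x \<bullet> h)) (at x)" if "x \<in> S" for x
    using has_derivative_mult[OF d(1)[rule_format, OF that] d(3)[rule_format, OF that]]
    by (simp add: D_def inner_add_left algebra_simps)
  moreover have "C_diff n S (\<lambda>x. D x \<bullet> b)" if "b \<in> Basis" for b
    using d that Suc.prems unfolding D_def inner_add_left inner_scaleR_left
    by (intro C_diff_add Suc.IH) (auto intro: C_diff_Suc_imp simp del: C_diff.simps)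
  ultimately show ?case
    by (auto intro!: exI[of _ D])
qed

lemma C_diff_minus: "C_diff n S f \<Longrightarrow> C_diff n S (\<lambda>x. - f x)"
  using C_diff_mult[OF C_diff_const[of n S "-1"]] by simp

lemma C_diff_diff: "C_diff n S f \<Longrightarrow> C_diff n S g \<Longrightarrow> C_diff n S (\<lambda>x. f x - g x)"
  using C_diff_add[OF _ C_diff_minus] by force

lemma C_diff_sum: "(\<And>i. i \<in> I \<Longrightarrow> C_diff n S (f i)) \<Longrightarrow> C_diff n S (\<lambda>x. \<Sum>i\<in>I. f i x)"
  by (induction I rule: infinite_finite_induct) (auto intro: C_diff_const C_diff_add)

lemma C_diff_prod: "(\<And>i. i \<in> I \<Longrightarrow> C_diff n S (f i)) \<Longrightarrow> C_diff n S (\<lambda>x. \<Prod>i\<in>I. f i x)"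
  by (induction I rule: infinite_finite_induct) (auto intro: C_diff_const C_diff_mult)

text \<open>The gradient is \<open>f'\<close> times minus the square of
  \<open>inverse (f x)\<close>, so the reciprocal reappears one order lower and the induction
  closes.\<close>

lemma C_diff_inverse:
  assumes "C_diff n S f" "\<And>x. x \<in> S \<Longrightarrow> f x \<noteq> 0"
  shows "C_diff n S (\<lambda>x. inverse (f x))"
  using assms
proof (induction n arbitrary: f)
  case 0
  then show ?case by (auto intro: continuous_on_inverse)
next
  case (Suc n)
  then obtain f' where
    d: "\<forall>x\<in>S. (f has_derivative (\<lambda>h. f' x \<bullet> h)) (at x)" "\<forall>b\<in>Basis. C_diff n S (\<lambda>x. f' x \<bullet> b)"
    by (auto simp only: C_diff.simps)
  define D where "D x = (- (inverse (f x) * inverse (f x))) *\<^sub>R f' x" for x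
  have "((\<lambda>x. inverse (f x)) has_derivative (\<lambda>h. D x \<bullet> h)) (at x)" if "x \<in> S" for x
    using Deriv.has_derivative_inverse[OF _ d(1)[rule_format, OF that]] Suc.prems(2)[OF that]
    by (simp add: D_def algebra_simps)
  moreover have "C_diff n S (\<lambda>x. D x \<bullet> b)" if "b \<in> Basis" for b
    using d that Suc.prems unfolding D_def inner_scaleR_left
    by (intro C_diff_mult C_diff_minus Suc.IH) (auto intro: C_diff_Suc_imp simp del: C_diff.simps)
  ultimately show ?case
    by (auto intro!: exI[of _ D])
qed

lemma C_diff_ln:
  assumes "C_diff n S f" "\<And>x. x \<in> S \<Longrightarrow> f x > 0"
  shows "C_diff n S (\<lambda>x. ln (f x))"
proof (cases n)
  case 0
  then show ?thesis using assms by (force intro: continuous_on_ln)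
next
  case (Suc m)
  then obtain f' where
    d: "\<forall>x\<in>S. (f has_derivative (\<lambda>h. f' x \<bullet> h)) (at x)" "\<forall>b\<in>Basis. C_diff m S (\<lambda>x. f' x \<bullet> b)"
    using assms by auto
  define D where "D x = inverse (f x) *\<^sub>R f' x" for x
  have "((\<lambda>x. ln (f x)) has_derivative (\<lambda>h. D x \<bullet> h)) (at x)" if "x \<in> S" for x
    using has_derivative_ln[OF _ d(1)[rule_format, OF that]] assms(2)[OF that]
    by (simp add: D_def divide_inverse mult_ac)
  moreover have "C_diff m S (\<lambda>x. D x \<bullet> b)" if "b \<in> Basis" for b
    using d that assms Suc unfolding D_def inner_scaleR_left
    by (intro C_diff_mult C_diff_inverse) (force intro: C_diff_Suc_imp simp del: C_diff.simps)+
  ultimately show ?thesis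
    using Suc by (auto intro!: exI[of _ D])
qed

lemma C_diff_det:
  fixes A :: "'a::euclidean_space \<Rightarrow> real^'n^'n"
  assumes "\<And>i j. C_diff n S (\<lambda>x. A x $ i $ j)"
  shows "C_diff n S (\<lambda>x. det (A x))"
  unfolding det_def by (intro C_diff_sum C_diff_mult C_diff_prod C_diff_const assms)

lemma C_diff_matrix_inv:
  fixes A :: "'a::euclidean_space \<Rightarrow> real^'n^'n"
  assumes "open S" "\<And>i j. C_diff n S (\<lambda>x. A x $ i $ j)" "\<And>x. x \<in> S \<Longrightarrow> det (A x) \<noteq> 0"
  shows "C_diff n S (\<lambda>x. matrix_inv (A x) $ k $ l)"
proof (rule C_diff_cong[OF assms(1)])
  let ?M = "\<lambda>x. \<chi> i j. if j = k then (if i = l then 1 else 0) else A x $ i $ j"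
  show "C_diff n S (\<lambda>x. det (?M x) * inverse (det (A x)))"
  proof (intro C_diff_mult C_diff_inverse C_diff_det assms)
    show "C_diff n S (\<lambda>x. ?M x $ i $ j)" for i j
      using assms(2) by (cases "j = k") (auto intro: C_diff_const)
  qed
qed (use assms(3) in \<open>simp add: matrix_inv_nth divide_inverse\<close>)

section \<open>Bounded linear derivatives assembled from componentwise gradients\<close>

definition blinfun_tensor :: "'a::euclidean_space \<Rightarrow> 'b::real_normed_vector \<Rightarrow> 'a \<Rightarrow>\<^sub>L 'b" where
  "blinfun_tensor c v = blinfun_scaleR_left v o\<^sub>L blinfun_inner_left c"

lemma has_derivative_scaleR_blinfun_tensor:
  fixes f :: "'a::euclidean_space \<Rightarrow> real" and v :: "'b::real_normed_vector"
  assumes "(f has_derivative (\<lambda>h. G \<bullet> h)) (at x)"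
  shows "((\<lambda>x. f x *\<^sub>R v) has_derivative (\<lambda>h. \<Sum>c\<in>Basis. ((G \<bullet> c) *\<^sub>R blinfun_tensor c v) h)) (at x)"
proof -
  have "(\<Sum>c\<in>Basis. ((G \<bullet> c) *\<^sub>R blinfun_tensor c v) h) = (G \<bullet> h) *\<^sub>R v" for h
    unfolding euclidean_inner[of G h]
    by (simp add: blinfun.scaleR_left blinfun_tensor_def scaleR_sum_left)
  then show ?thesis
    using has_derivative_scaleR_left[OF assms, of v] by simp
qed

text \<open>\<open>blinfun_tensor c v\<close> is the rank-one map taking \<open>h\<close> to
  \<open>(h \<bullet> c) *\<^sub>R v\<close>. Each derivative is expanded in fixed tensors built
  from basis vectors, with gradient components as coefficients. Differentiation then touches only
  real-valued coefficients and adds one tensor factor per order.\<close>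

lemma C_diff_3_blinfun_derivatives:
  fixes f :: "'a::euclidean_space \<Rightarrow> real"
  assumes "C_diff 3 S f"
  obtains D1 :: "'a \<Rightarrow> 'a \<Rightarrow>\<^sub>L real" and D2 :: "'a \<Rightarrow> 'a \<Rightarrow>\<^sub>L 'a \<Rightarrow>\<^sub>L real"
    and D3 :: "'a \<Rightarrow> 'a \<Rightarrow>\<^sub>L 'a \<Rightarrow>\<^sub>L 'a \<Rightarrow>\<^sub>L real"
  where "\<And>x. x \<in> S \<Longrightarrow> (f has_derivative blinfun_apply (D1 x)) (at x)"
    and "\<And>x. x \<in> S \<Longrightarrow> (D1 has_derivative blinfun_apply (D2 x)) (at x)"
    and "\<And>x. x \<in> S \<Longrightarrow> (D2 has_derivative blinfun_apply (D3 x)) (at x)"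
    and "continuous_on S D3"
proof -
  from assms obtain g where
    g: "\<And>x. x \<in> S \<Longrightarrow> (f has_derivative (\<lambda>h. g x \<bullet> h)) (at x)"
      "\<forall>b\<in>Basis. C_diff 2 S (\<lambda>x. g x \<bullet> b)"
    by (auto simp: eval_nat_numeral)
  then have "\<forall>b\<in>Basis. \<exists>g2. (\<forall>x\<in>S. ((\<lambda>x. g x \<bullet> b) has_derivative (\<lambda>h. g2 x \<bullet> h)) (at x)) \<and>
     (\<forall>c\<in>Basis. C_diff 1 S (\<lambda>x. g2 x \<bullet> c))"
    by (auto simp: numeral_2_eq_2)
  from bchoice[OF this] obtain g2 where
    g2: "\<And>b x. b \<in> Basis \<Longrightarrow> x \<in> S \<Longrightarrow> ((\<lambda>x. g x \<bullet> b) has_derivative (\<lambda>h. g2 b x \<bullet> h)) (at x)"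
      "\<forall>b\<in>Basis. \<forall>c\<in>Basis. C_diff 1 S (\<lambda>x. g2 b x \<bullet> c)"
    by blast
  then have "\<forall>b\<in>Basis. \<forall>c\<in>Basis. \<exists>g3. (\<forall>x\<in>S. ((\<lambda>x. g2 b x \<bullet> c) has_derivative (\<lambda>h. g3 x \<bullet> h)) (at x)) \<and>
     (\<forall>e\<in>Basis. continuous_on S (\<lambda>x. g3 x \<bullet> e))"
    by auto
  then have "\<exists>g3. \<forall>b\<in>Basis. \<forall>c\<in>Basis. (\<forall>x\<in>S. ((\<lambda>x. g2 b x \<bullet> c) has_derivative (\<lambda>h. g3 b c x \<bullet> h)) (at x)) \<and>
     (\<forall>e\<in>Basis. continuous_on S (\<lambda>x. g3 b c x \<bullet> e))"
    by metis
  then obtain g3 where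
    g3: "\<And>b c x. b \<in> Basis \<Longrightarrow> c \<in> Basis \<Longrightarrow> x \<in> S \<Longrightarrow>
            ((\<lambda>x. g2 b x \<bullet> c) has_derivative (\<lambda>h. g3 b c x \<bullet> h)) (at x)"
      "\<And>b c e. b \<in> Basis \<Longrightarrow> c \<in> Basis \<Longrightarrow> e \<in> Basis \<Longrightarrow> continuous_on S (\<lambda>x. g3 b c x \<bullet> e)"
    by blast
  define D1 where "D1 x = (\<Sum>b\<in>Basis. (g x \<bullet> b) *\<^sub>R blinfun_inner_left b)" for x
  define D2 where "D2 x = (\<Sum>b\<in>Basis. \<Sum>c\<in>Basis. (g2 b x \<bullet> c) *\<^sub>R blinfun_tensor c (blinfun_inner_left b))" for x
  define D3 where "D3 x = (\<Sum>b\<in>Basis. \<Sum>c\<in>Basis. \<Sum>e\<in>Basis.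
      (g3 b c x \<bullet> e) *\<^sub>R blinfun_tensor e (blinfun_tensor c (blinfun_inner_left b)))" for x
  have "D1 x h = g x \<bullet> h" for x h
    unfolding euclidean_inner[of "g x" h] by (simp add: D1_def blinfun.sum_left blinfun.scaleR_left)
  then have "blinfun_apply (D1 x) = (\<lambda>h. g x \<bullet> h)" for x
    by auto
  then have "(f has_derivative blinfun_apply (D1 x)) (at x)" if "x \<in> S" for x
    using g(1)[OF that] by simp
  moreover have "(D1 has_derivative blinfun_apply (D2 x)) (at x)" if "x \<in> S" for x
    unfolding D1_def[abs_def] D2_def blinfun.sum_left
    using that by (intro has_derivative_sum has_derivative_scaleR_blinfun_tensor g2) auto
  moreover have "(D2 has_derivative blinfun_apply (D3 x)) (at x)" if "x \<in> S" for x
    unfolding D2_def[abs_def] D3_def blinfun.sum_left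
    using that by (intro has_derivative_sum has_derivative_scaleR_blinfun_tensor g3) auto
  moreover have "continuous_on S D3"
    unfolding D3_def[abs_def] by (intro continuous_intros g3)
  ultimately show thesis
    using that by blast
qed

section \<open>Derivatives of determinants and inverses\<close>

lemma tendsto_det:
  fixes A :: "'a \<Rightarrow> real^'n^'n"
  assumes "(A \<longlongrightarrow> A0) F"
  shows "((\<lambda>x. det (A x)) \<longlongrightarrow> det A0) F"
  unfolding det_def by (intro tendsto_intros assms)

lemma tendsto_matrix_inv:
  fixes A :: "'a \<Rightarrow> real^'n^'n"
  assumes A: "(A \<longlongrightarrow> A0) F" and "det A0 \<noteq> 0"
  shows "((\<lambda>x. matrix_inv (A x)) \<longlongrightarrow> matrix_inv A0) F"
proof (intro vec_tendstoI)
  fix k l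
  let ?M = "\<lambda>A :: real^'n^'n. \<chi> i j. if j = k then (if i = l then 1 else 0) else A $ i $ j"
  have "((\<lambda>x. ?M (A x)) \<longlongrightarrow> ?M A0) F"
    by (intro vec_tendstoI) (auto intro!: tendsto_intros A)
  then have "((\<lambda>x. det (?M (A x)) / det (A x)) \<longlongrightarrow> det (?M A0) / det A0) F"
    using assms by (intro tendsto_divide tendsto_det)
  moreover have "\<forall>\<^sub>F x in F. det (A x) \<noteq> 0"
    using tendsto_det[OF A] assms(2) by (rule tendsto_imp_eventually_ne)
  then have "\<forall>\<^sub>F x in F. det (?M (A x)) / det (A x) = matrix_inv (A x) $ k $ l"
    by eventually_elim (simp add: matrix_inv_nth)
  ultimately show "((\<lambda>x. matrix_inv (A x) $ k $ l) \<longlongrightarrow> matrix_inv A0 $ k $ l) F"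
    using assms(2) by (auto simp: matrix_inv_nth intro: Lim_transform_eventually)
qed

text \<open>Jacobi's formula. Differentiating the Leibniz expansion gives the sum of the
  determinants \<open>det (M i)\<close>, where row \<open>i\<close> is replaced by its
  derivative.\<close>

lemma det_has_real_derivative:
  fixes A :: "real \<Rightarrow> real^'n^'n"
  assumes A: "(A has_vector_derivative A') (at t)" and nz: "det (A t) \<noteq> 0"
  shows "((\<lambda>t. det (A t)) has_real_derivative det (A t) * trace (matrix_inv (A t) ** A')) (at t)"
proof -
  have entry: "((\<lambda>t. A t $ i $ j) has_real_derivative A' $ i $ j) (at t)" for i j
    unfolding has_real_derivative_iff_has_vector_derivative
    by (rule bounded_linear.has_vector_derivative[OF bounded_linear_vec_nth],
        rule bounded_linear.has_vector_derivative[OF bounded_linear_vec_nth A])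
  define M where "M i = (\<chi> k. if k = i then A' $ i else A t $ k)" for i
  define P where "P = {p. p permutes (UNIV :: 'n set)}"
  have prod_M: "(\<Prod>j\<in>UNIV. M i $ j $ p j) = A' $ i $ p i * (\<Prod>j\<in>UNIV - {i}. A t $ j $ p j)" for i p
    by (subst prod.remove[of _ i]) (auto simp: M_def intro!: prod.cong)
  have "((\<lambda>t. det (A t)) has_real_derivative (\<Sum>p\<in>P. of_int (sign p) *
      (\<Sum>i\<in>UNIV. A' $ i $ p i * (\<Prod>j\<in>UNIV - {i}. A t $ j $ p j)))) (at t)"
    unfolding det_def P_def[symmetric]
    by (intro DERIV_sum DERIV_cmult has_field_derivative_prod entry)
  also have "(\<Sum>p\<in>P. of_int (sign p) *
      (\<Sum>i\<in>UNIV. A' $ i $ p i * (\<Prod>j\<in>UNIV - {i}. A t $ j $ p j))) = (\<Sum>i\<in>UNIV. det (M i))"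
    unfolding det_def P_def[symmetric] prod_M sum_distrib_left by (rule sum.swap)
  \<comment> \<open>Row \<open>i\<close> of \<open>A'\<close> is a combination of the rows of
    \<open>A t\<close> with coefficients from \<open>A' ** matrix_inv (A t)\<close>. The determinant
    is multilinear and alternating, so only the \<open>i\<close>-th coefficient survives.\<close>
  also have "\<dots> = (\<Sum>i\<in>UNIV. (A' ** matrix_inv (A t)) $ i $ i * det (A t))"
  proof (rule sum.cong[OF refl])
    fix i
    let ?c = "(A' ** matrix_inv (A t)) $ i"
    have "(A' ** matrix_inv (A t)) ** A t = A'"
      using nz by (simp add: invertible_det_nz matrix_inv_mult flip: matrix_mul_assoc)
    then have "A' $ i = (\<Sum>j\<in>UNIV. ?c $ j *s row j (A t))"
      using matrix_mul_sum_alt[of "A' ** matrix_inv (A t)" "A t"] by (simp add: row_def vec_eq_iff)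
    moreover have "M i = (\<chi> k. if k = i then A' $ i else row k (A t))"
      by (simp add: M_def row_def vec_eq_iff)
    ultimately show "det (M i) = ?c $ i * det (A t)"
      using cramer_lemma_transpose[of i ?c "A t"] by (simp only:)
  qed
  also have "\<dots> = det (A t) * trace (A' ** matrix_inv (A t))"
    by (simp add: trace_def sum_distrib_left mult.commute)
  finally show ?thesis
    by (simp add: trace_mul_sym[of A'])
qed

lemma ln_det_has_real_derivative:
  fixes A :: "real \<Rightarrow> real^'n^'n"
  assumes "(A has_vector_derivative A') (at t)" "det (A t) > 0"
  shows "((\<lambda>t. ln (det (A t))) has_real_derivative trace (matrix_inv (A t) ** A')) (at t)"
  using assms by (auto intro!: derivative_eq_intros det_has_real_derivative)

lemma has_vector_derivative_iff_LIM:
  "(f has_vector_derivative f') (at t) \<longleftrightarrow> ((\<lambda>s. (f s - f t) /\<^sub>R (s - t)) \<longlongrightarrow> f') (at t)"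
proof -
  have "norm (f s - f t - (s - t) *\<^sub>R f') / norm (s - t) = norm ((f s - f t) /\<^sub>R (s - t) - f')"
    if "s \<noteq> t" for s
  proof -
    have "f s - f t - (s - t) *\<^sub>R f' = (s - t) *\<^sub>R ((f s - f t) /\<^sub>R (s - t) - f')"
      using that by (simp add: scaleR_diff_right)
    then show ?thesis using that by simp
  qed
  then have "\<forall>\<^sub>F s in at t. norm (f s - f t - (s - t) *\<^sub>R f') / norm (s - t) =
      norm ((f s - f t) /\<^sub>R (s - t) - f')"
    by (auto simp: eventually_at_filter)
  then show ?thesis
    by (simp add: has_vector_derivative_def has_derivative_iff_norm bounded_linear_scaleR_left
        tendsto_cong tendsto_norm_zero_iff LIM_zero_iff)
qed

text \<open>The difference of the inverses at \<open>s\<close> and \<open>t\<close> equals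
  \<open>- (matrix_inv (A s) ** (A s - A t) ** matrix_inv (A t))\<close>. After division by
  \<open>s - t\<close>, continuity of the inverse gives the limit.\<close>

lemma matrix_inv_has_vector_derivative:
  fixes A :: "real \<Rightarrow> real^'n^'n"
  assumes A: "(A has_vector_derivative A') (at t)" and nz: "det (A t) \<noteq> 0"
  shows "((\<lambda>t. matrix_inv (A t)) has_vector_derivative
           - (matrix_inv (A t) ** A' ** matrix_inv (A t))) (at t)"
proof -
  have cont: "(A \<longlongrightarrow> A t) (at t)"
    using A by (meson continuous_at has_vector_derivative_continuous)
  let ?q = "\<lambda>s. (A s - A t) /\<^sub>R (s - t)"
  have "(?q \<longlongrightarrow> A') (at t)"
    using A by (simp add: has_vector_derivative_iff_LIM)
  then have "((\<lambda>s. - (matrix_inv (A s) ** ?q s ** matrix_inv (A t))) \<longlongrightarrow>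
      - (matrix_inv (A t) ** A' ** matrix_inv (A t))) (at t)"
    by (intro tendsto_minus matrix_mult.tendsto tendsto_const tendsto_matrix_inv cont nz)
  moreover have "\<forall>\<^sub>F s in at t. det (A s) \<noteq> 0"
    using tendsto_det[OF cont] nz by (rule tendsto_imp_eventually_ne)
  then have "\<forall>\<^sub>F s in at t. - (matrix_inv (A s) ** ?q s ** matrix_inv (A t)) =
      (matrix_inv (A s) - matrix_inv (A t)) /\<^sub>R (s - t)"
  proof eventually_elim
    case (elim s)
    have "matrix_inv (A s) ** (A s - A t) ** matrix_inv (A t) = matrix_inv (A t) - matrix_inv (A s)"
      using elim nz by (simp add: matrix_mult.diff_right matrix_mult.diff_left matrix_inv_mult invertible_det_nz
          flip: matrix_mul_assoc)
    then show ?case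
      by (simp add: matrix_mult_scaleR_left matrix_mult_scaleR_right flip: scaleR_minus_right)
  qed
  ultimately have "((\<lambda>s. (matrix_inv (A s) - matrix_inv (A t)) /\<^sub>R (s - t)) \<longlongrightarrow>
      - (matrix_inv (A t) ** A' ** matrix_inv (A t))) (at t)"
    by (rule Lim_transform_eventually)
  then show ?thesis
    by (simp add: has_vector_derivative_iff_LIM)
qed

section \<open>The barrier along a line\<close>

text \<open>The complement left after eliminating the \<open>w\<close> blocks of the block arrow
  matrix with diagonal blocks \<open>Y\<close> and borders \<open>- B k\<close>. The next three
  definitions are its derivatives along a line with velocity \<open>H\<close> in \<open>Y\<close>
  and \<open>C\<close> in \<open>B\<close>.\<close>

definition schur :: "real^'l^'l \<Rightarrow> ('k::finite \<Rightarrow> real^'l^'l) \<Rightarrow> real^'l^'l" where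
  "schur Y B = Y - (\<Sum>k\<in>UNIV. B k ** matrix_inv Y ** B k)"

definition schur_d1 :: "real^'l^'l \<Rightarrow> ('k::finite \<Rightarrow> real^'l^'l) \<Rightarrow> real^'l^'l \<Rightarrow> ('k \<Rightarrow> real^'l^'l) \<Rightarrow> real^'l^'l" where
  "schur_d1 Y B H C = (let J = matrix_inv Y in
     H - (\<Sum>k\<in>UNIV. C k ** J ** B k + B k ** J ** C k - B k ** J ** H ** J ** B k))"

definition schur_d2 :: "real^'l^'l \<Rightarrow> ('k::finite \<Rightarrow> real^'l^'l) \<Rightarrow> real^'l^'l \<Rightarrow> ('k \<Rightarrow> real^'l^'l) \<Rightarrow> real^'l^'l" where
  "schur_d2 Y B H C = (let J = matrix_inv Y in
     - 2 *\<^sub>R (\<Sum>k\<in>UNIV. (C k - B k ** J ** H) ** J ** (C k - H ** J ** B k)))"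

definition schur_d3 :: "real^'l^'l \<Rightarrow> ('k::finite \<Rightarrow> real^'l^'l) \<Rightarrow> real^'l^'l \<Rightarrow> ('k \<Rightarrow> real^'l^'l) \<Rightarrow> real^'l^'l" where
  "schur_d3 Y B H C = (let J = matrix_inv Y in
     6 *\<^sub>R (\<Sum>k\<in>UNIV. (C k - B k ** J ** H) ** J ** H ** J ** (C k - H ** J ** B k)))"

lemmas matrix_mult_simps =
  matrix_mult.add_left matrix_mult.add_right matrix_mult.diff_left matrix_mult.diff_right
  matrix_mult.minus_left matrix_mult.minus_right matrix_mult_scaleR_left matrix_mult_scaleR_right
  matrix_mul_assoc

context
  fixes B J :: "real \<Rightarrow> real^'l^'l" and C H :: "real^'l^'l" and t :: real
  assumes B: "(B has_vector_derivative C) (at t)"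
    and J: "(J has_vector_derivative - (J t ** H ** J t)) (at t)"
begin

lemma schur_term_derivative1:
  "((\<lambda>t. B t ** J t ** B t) has_vector_derivative
     C ** J t ** B t + B t ** J t ** C - B t ** J t ** H ** J t ** B t) (at t)"
  by (rule has_vector_derivative_eq_rhs, (rule matrix_mult.has_vector_derivative B J)+)
    (simp add: matrix_mult_simps)

text \<open>The expansion collects into a product whose outer factors are transposes of each other
  for symmetric matrices. This definite shape is the source of convexity.\<close>

lemma schur_term_derivative2:
  "((\<lambda>t. C ** J t ** B t + B t ** J t ** C - B t ** J t ** H ** J t ** B t) has_vector_derivative
     2 *\<^sub>R ((C - B t ** J t ** H) ** J t ** (C - H ** J t ** B t))) (at t)"
  by (rule has_vector_derivative_eq_rhs,
      (rule has_vector_derivative_add has_vector_derivative_diff matrix_mult.has_vector_derivative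
        has_vector_derivative_const B J)+)
    (simp only: matrix_mult_simps matrix_mult.zero_left matrix_mult.zero_right scaleR_2
      diff_conv_add_uminus minus_add_distrib minus_minus minus_zero add_0_left add_0_right add_ac)

text \<open>The outer factors satisfy \<open>L' = - (L ** J ** H)\<close> and
  \<open>R' = - (H ** J ** R)\<close>, and \<open>J' = - (J ** H ** J)\<close>. Each of the three
  factors thus contributes the same term, hence the \<open>- 3\<close>.\<close>

lemma schur_term_derivative3:
  "((\<lambda>t. (C - B t ** J t ** H) ** J t ** (C - H ** J t ** B t)) has_vector_derivative
     - 3 *\<^sub>R ((C - B t ** J t ** H) ** J t ** H ** J t ** (C - H ** J t ** B t))) (at t)"
proof -
  let ?L = "C - B t ** J t ** H" and ?R = "C - H ** J t ** B t"
  have "((\<lambda>t. C - B t ** J t ** H) has_vector_derivative - (?L ** J t ** H)) (at t)"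
    by (rule has_vector_derivative_eq_rhs,
        (rule has_vector_derivative_diff matrix_mult.has_vector_derivative
          has_vector_derivative_const B J)+)
      (simp add: matrix_mult_simps)
  moreover have "((\<lambda>t. C - H ** J t ** B t) has_vector_derivative - (H ** J t ** ?R)) (at t)"
    by (rule has_vector_derivative_eq_rhs,
        (rule has_vector_derivative_diff matrix_mult.has_vector_derivative
          has_vector_derivative_const B J)+)
      (simp add: matrix_mult_simps)
  ultimately have "((\<lambda>t. (C - B t ** J t ** H) ** J t ** (C - H ** J t ** B t)) has_vector_derivative
      ?L ** J t ** - (H ** J t ** ?R) + (?L ** - (J t ** H ** J t) + - (?L ** J t ** H) ** J t) ** ?R) (at t)"
    by (intro matrix_mult.has_vector_derivative J)
  moreover have "?L ** J t ** - (H ** J t ** ?R) + (?L ** - (J t ** H ** J t) + - (?L ** J t ** H) ** J t) ** ?R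
      = - 3 *\<^sub>R (?L ** J t ** H ** J t ** ?R)"
  proof -
    have "L ** J t ** - (H ** J t ** R) + (L ** - (J t ** H ** J t) + - (L ** J t ** H) ** J t) ** R
        = - 3 *\<^sub>R (L ** J t ** H ** J t ** R)" for L R
      by (simp only: matrix_mult_simps) (simp add: vec_eq_iff)
    then show ?thesis .
  qed
  ultimately show ?thesis by simp
qed

end

definition bar :: "real^'l^'l \<Rightarrow> ('k::finite \<Rightarrow> real^'l^'l) \<Rightarrow> real" where
  "bar Y B = - ln (det (schur Y B)) - ln (det Y)"

definition bar_d1 :: "real^'l^'l \<Rightarrow> ('k::finite \<Rightarrow> real^'l^'l) \<Rightarrow> real^'l^'l \<Rightarrow> ('k \<Rightarrow> real^'l^'l) \<Rightarrow> real" where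
  "bar_d1 Y B H C = - trace (matrix_inv (schur Y B) ** schur_d1 Y B H C) - trace (matrix_inv Y ** H)"

definition bar_d2 :: "real^'l^'l \<Rightarrow> ('k::finite \<Rightarrow> real^'l^'l) \<Rightarrow> real^'l^'l \<Rightarrow> ('k \<Rightarrow> real^'l^'l) \<Rightarrow> real" where
  "bar_d2 Y B H C = (let K = matrix_inv (schur Y B); X = K ** schur_d1 Y B H C; N = matrix_inv Y ** H in
     trace (X ** X) - trace (K ** schur_d2 Y B H C) + trace (N ** N))"

definition bar_d3 :: "real^'l^'l \<Rightarrow> ('k::finite \<Rightarrow> real^'l^'l) \<Rightarrow> real^'l^'l \<Rightarrow> ('k \<Rightarrow> real^'l^'l) \<Rightarrow> real" where
  "bar_d3 Y B H C = (let K = matrix_inv (schur Y B); X = K ** schur_d1 Y B H C; N = matrix_inv Y ** H in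
     - 2 * trace (X ** X ** X) + 3 * trace (X ** K ** schur_d2 Y B H C)
       - trace (K ** schur_d3 Y B H C) - 2 * trace (N ** N ** N))"

context
  fixes Y :: "real \<Rightarrow> real^'l^'l" and B :: "real \<Rightarrow> 'k::finite \<Rightarrow> real^'l^'l"
    and H :: "real^'l^'l" and C :: "'k \<Rightarrow> real^'l^'l" and t :: real
  assumes Y: "(Y has_vector_derivative H) (at t)"
    and B: "\<And>k. ((\<lambda>t. B t k) has_vector_derivative C k) (at t)"
    and Y_pos: "det (Y t) > 0"
begin

private lemma J: "((\<lambda>t. matrix_inv (Y t)) has_vector_derivative
    - (matrix_inv (Y t) ** H ** matrix_inv (Y t))) (at t)"
  using matrix_inv_has_vector_derivative[OF Y] Y_pos by simp

lemma schur_derivative: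
  "((\<lambda>t. schur (Y t) (B t)) has_vector_derivative schur_d1 (Y t) (B t) H C) (at t)"
  unfolding schur_def schur_d1_def Let_def
  by (intro has_vector_derivative_diff has_vector_derivative_sum Y schur_term_derivative1 B J)

lemma schur_d1_derivative:
  "((\<lambda>t. schur_d1 (Y t) (B t) H C) has_vector_derivative schur_d2 (Y t) (B t) H C) (at t)"
proof -
  have "((\<lambda>t. schur_d1 (Y t) (B t) H C) has_vector_derivative 0 -
     (\<Sum>k\<in>UNIV. 2 *\<^sub>R ((C k - B t k ** matrix_inv (Y t) ** H) ** matrix_inv (Y t) **
       (C k - H ** matrix_inv (Y t) ** B t k)))) (at t)"
    unfolding schur_d1_def Let_def
    by (intro has_vector_derivative_diff has_vector_derivative_sum has_vector_derivative_const
        schur_term_derivative2 B J)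
  then show ?thesis
    by (simp add: schur_d2_def Let_def flip: scaleR_sum_right)
qed

lemma schur_d2_derivative:
  "((\<lambda>t. schur_d2 (Y t) (B t) H C) has_vector_derivative schur_d3 (Y t) (B t) H C) (at t)"
proof -
  have "((\<lambda>t. schur_d2 (Y t) (B t) H C) has_vector_derivative - 2 *\<^sub>R
     (\<Sum>k\<in>UNIV. - 3 *\<^sub>R ((C k - B t k ** matrix_inv (Y t) ** H) ** matrix_inv (Y t) ** H **
       matrix_inv (Y t) ** (C k - H ** matrix_inv (Y t) ** B t k)))) (at t)"
    unfolding schur_d2_def Let_def
    by (intro bounded_linear.has_vector_derivative[OF bounded_linear_scaleR_right]
        has_vector_derivative_sum schur_term_derivative3 B J)
  then show ?thesis
    by (simp add: schur_d3_def Let_def sum_negf flip: scaleR_sum_right)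
qed

context
  assumes G_pos: "det (schur (Y t) (B t)) > 0"
begin

private lemma K: "((\<lambda>t. matrix_inv (schur (Y t) (B t))) has_vector_derivative
    - (matrix_inv (schur (Y t) (B t)) ** schur_d1 (Y t) (B t) H C ** matrix_inv (schur (Y t) (B t)))) (at t)"
  using matrix_inv_has_vector_derivative[OF schur_derivative] G_pos by simp

private lemmas trace_derivative = bounded_linear.has_vector_derivative[OF bounded_linear_trace]

lemma bar_derivative:
  "((\<lambda>t. bar (Y t) (B t)) has_real_derivative bar_d1 (Y t) (B t) H C) (at t)"
  unfolding bar_def bar_d1_def
  by (intro DERIV_diff DERIV_minus ln_det_has_real_derivative schur_derivative Y Y_pos G_pos)

private lemma N: "((\<lambda>t. matrix_inv (Y t) ** H) has_vector_derivative
    - (matrix_inv (Y t) ** H ** (matrix_inv (Y t) ** H))) (at t)"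
  by (rule has_vector_derivative_eq_rhs,
      (rule matrix_mult.has_vector_derivative has_vector_derivative_const J)+)
    (simp add: matrix_mult_simps)

private lemma X: "((\<lambda>t. matrix_inv (schur (Y t) (B t)) ** schur_d1 (Y t) (B t) H C) has_vector_derivative
    matrix_inv (schur (Y t) (B t)) ** schur_d2 (Y t) (B t) H C -
    matrix_inv (schur (Y t) (B t)) ** schur_d1 (Y t) (B t) H C **
      (matrix_inv (schur (Y t) (B t)) ** schur_d1 (Y t) (B t) H C)) (at t)"
  by (rule has_vector_derivative_eq_rhs,
      (rule matrix_mult.has_vector_derivative schur_d1_derivative K)+)
    (simp add: matrix_mult_simps)

lemma bar_d1_derivative:
  "((\<lambda>t. bar_d1 (Y t) (B t) H C) has_real_derivative bar_d2 (Y t) (B t) H C) (at t)"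
  unfolding bar_d1_def has_real_derivative_iff_has_vector_derivative
  by (rule has_vector_derivative_eq_rhs,
      (rule has_vector_derivative_diff has_vector_derivative_minus trace_derivative X N)+)
    (simp add: bar_d2_def Let_def trace_diff trace_minus)

text \<open>From \<open>X' = K ** G2 - X ** X\<close>, the term \<open>trace (X ** X)\<close> yields
  two copies of \<open>trace (X ** K ** G2)\<close>, merged by cyclicity of the trace. A third comes
  from \<open>K' = - (X ** K)\<close> inside \<open>- trace (K ** G2)\<close>; this explains the
  coefficient 3 in \<open>bar_d3\<close>.\<close>

lemma bar_d2_derivative:
  "((\<lambda>t. bar_d2 (Y t) (B t) H C) has_real_derivative bar_d3 (Y t) (B t) H C) (at t)"
proof -
  define K where "K t = matrix_inv (schur (Y t) (B t))" for t
  define X where "X t = K t ** schur_d1 (Y t) (B t) H C" for t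
  define N where "N t = matrix_inv (Y t) ** H" for t
  let ?G2 = "\<lambda>t. schur_d2 (Y t) (B t) H C" and ?G3 = "schur_d3 (Y t) (B t) H C"
  have X': "(X has_vector_derivative K t ** ?G2 t - X t ** X t) (at t)"
    using X unfolding X_def[abs_def] K_def .
  have N': "(N has_vector_derivative - (N t ** N t)) (at t)"
    using N unfolding N_def[abs_def] .
  have K': "(K has_vector_derivative - (X t ** K t)) (at t)"
    using K unfolding X_def K_def[abs_def] .
  have KG: "((\<lambda>t. K t ** ?G2 t) has_vector_derivative K t ** ?G3 - X t ** K t ** ?G2 t) (at t)"
    by (rule has_vector_derivative_eq_rhs,
        (rule matrix_mult.has_vector_derivative schur_d2_derivative K')+)
      (simp add: matrix_mult_simps)
  have "((\<lambda>t. trace (X t ** X t) - trace (K t ** ?G2 t) + trace (N t ** N t)) has_vector_derivative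
     trace (X t ** (K t ** ?G2 t - X t ** X t) + (K t ** ?G2 t - X t ** X t) ** X t)
     - trace (K t ** ?G3 - X t ** K t ** ?G2 t)
     + trace (N t ** - (N t ** N t) + - (N t ** N t) ** N t)) (at t)"
    by (intro has_vector_derivative_add has_vector_derivative_diff trace_derivative
        matrix_mult.has_vector_derivative X' N' KG)
  also have "trace (X t ** (K t ** ?G2 t - X t ** X t) + (K t ** ?G2 t - X t ** X t) ** X t)
     - trace (K t ** ?G3 - X t ** K t ** ?G2 t)
     + trace (N t ** - (N t ** N t) + - (N t ** N t) ** N t) = bar_d3 (Y t) (B t) H C"
  proof -
    have "bar_d3 (Y t) (B t) H C = - 2 * trace (X t ** X t ** X t) + 3 * trace (X t ** K t ** ?G2 t)
        - trace (K t ** ?G3) - 2 * trace (N t ** N t ** N t)"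
      by (simp add: bar_d3_def Let_def K_def X_def N_def)
    then show ?thesis
      using trace_mul_sym[of "K t ** ?G2 t" "X t"]
      by (simp only: matrix_mult_simps trace_add trace_diff trace_minus)
  qed
  finally show ?thesis
    unfolding bar_d2_def Let_def has_real_derivative_iff_has_vector_derivative
    by (simp flip: K_def X_def N_def)
qed

end

end

section \<open>The self-concordance inequality\<close>

lemma trace_cube_2x2_le:
  fixes a h q :: real
  shows "a ^ 3 + h ^ 3 + 3 * (a + h) * q\<^sup>2 \<le> (a\<^sup>2 + h\<^sup>2 + 2 * q\<^sup>2) powr (3/2)"
proof -
  define z where "z = a\<^sup>2 + h\<^sup>2 + 2 * q\<^sup>2"
  have z: "z \<ge> 0" by (simp add: z_def)
  \<comment> \<open>With \<open>M\<close> the matrix with rows \<open>(a, q)\<close> and \<open>(q, h)\<close>, this is \<open>(tr M\<^sup>2)\<^sup>3 - (tr M\<^sup>3)\<^sup>2\<close>.\<close>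
  have "z ^ 3 - (a ^ 3 + h ^ 3 + 3 * (a + h) * q\<^sup>2)\<^sup>2 =
      (a * h - q\<^sup>2)\<^sup>2 * ((a - h)\<^sup>2 + 2 * a\<^sup>2 + 2 * h\<^sup>2 + 8 * q\<^sup>2)"
    unfolding z_def by algebra
  also have "\<dots> \<ge> 0" by simp
  finally have "(a ^ 3 + h ^ 3 + 3 * (a + h) * q\<^sup>2)\<^sup>2 \<le> z ^ 3"
    by simp
  then have "a ^ 3 + h ^ 3 + 3 * (a + h) * q\<^sup>2 \<le> sqrt (z ^ 3)"
    by (rule real_le_rsqrt)
  also have "\<dots> = z powr (3/2)"
    using z by (cases "z = 0") (simp_all add: powr_half_sqrt[symmetric] powr_powr flip: powr_numeral)
  finally show ?thesis unfolding z_def .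
qed

text \<open>Cyclicity of the trace moves the factors \<open>R\<close> and \<open>T\<close> of the
  two inverses around, so that every trace is expressed by \<open>A\<close>, \<open>M\<close> and
  \<open>V k\<close>. The second derivative becomes an exact sum of squared Frobenius norms;
  Cauchy-Schwarz and submultiplicativity bound the third.\<close>

lemma
  fixes Y :: "real^'l^'l" and B :: "'k::finite \<Rightarrow> real^'l^'l"
  assumes Y: "pos_def Y" and G: "pos_def (schur Y B)"
    and symB: "\<And>k. transpose (B k) = B k" and symH: "transpose H = H"
    and symC: "\<And>k. transpose (C k) = C k"
  shows bar_d2_nonneg: "0 \<le> bar_d2 Y B H C"
    and bar_d3_le: "\<bar>bar_d3 Y B H C\<bar> \<le> 2 * (bar_d2 Y B H C) powr (3/2)"
proof -
  define J K where "J = matrix_inv Y" and "K = matrix_inv (schur Y B)"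
  obtain T :: "real^'l^'l" where T: "J = T ** transpose T"
    using pos_def_inverse_factor[OF Y] unfolding J_def .
  obtain R :: "real^'l^'l" where R: "K = R ** transpose R"
    using pos_def_inverse_factor[OF G] unfolding K_def .
  have symJ: "transpose J = J"
    by (simp add: T matrix_transpose_mul)
  define G1 where "G1 = schur_d1 Y B H C"
  have symG1: "transpose G1 = G1"
    unfolding G1_def schur_d1_def Let_def J_def[symmetric]
    by (simp add: transpose_diff transpose_add transpose_sum matrix_transpose_mul symB symC symH symJ
        matrix_mul_assoc add.commute)
  define A where "A = transpose R ** G1 ** R"
  define M where "M = transpose T ** H ** T"
  define V where "V k = transpose T ** (C k - H ** J ** B k) ** R" for k
  have symA: "transpose A = A" and symM: "transpose M = M"
    by (simp_all add: A_def M_def matrix_transpose_mul symG1 symH matrix_mul_assoc)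
  \<comment> \<open>Symmetry of \<open>B k\<close>, \<open>C k\<close>, \<open>H\<close> and
    \<open>J\<close> makes the left outer factor in \<open>schur_d2\<close> the transpose of the
    right one, so the form pairs \<open>V k\<close> with its own transpose.\<close>
  have tV: "transpose (V k) = transpose R ** (C k - B k ** J ** H) ** T" for k
    by (simp add: V_def matrix_transpose_mul transpose_diff symB symC symH symJ matrix_mul_assoc)
  define a h q where "a = norm A" and "h = norm M" and "q = sqrt (\<Sum>k\<in>UNIV. (norm (V k))\<^sup>2)"
  have q2: "q\<^sup>2 = (\<Sum>k\<in>UNIV. (norm (V k))\<^sup>2)"
    by (simp add: q_def sum_nonneg)
  define X N where "X = K ** G1" and "N = J ** H"
  have XX: "trace (X ** X) = a\<^sup>2"
  proof -
    have "trace (X ** X) = trace (A ** A)"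
      using trace_mul_sym[of R "transpose R ** G1 ** R ** transpose R ** G1"]
      by (simp add: X_def R A_def matrix_mul_assoc)
    then show ?thesis
      by (simp add: a_def power2_norm_eq_inner inner_matrix_eq_trace symA)
  qed
  have NN: "trace (N ** N) = h\<^sup>2"
  proof -
    have "trace (N ** N) = trace (M ** M)"
      using trace_mul_sym[of T "transpose T ** H ** T ** transpose T ** H"]
      by (simp add: N_def T M_def matrix_mul_assoc)
    then show ?thesis
      by (simp add: h_def power2_norm_eq_inner inner_matrix_eq_trace symM)
  qed
  have KG2: "trace (K ** schur_d2 Y B H C) = - 2 * q\<^sup>2"
  proof -
    have "trace (K ** ((C k - B k ** J ** H) ** J ** (C k - H ** J ** B k))) = (norm (V k))\<^sup>2" for k
      using trace_mul_sym[of R "transpose R ** ((C k - B k ** J ** H) ** J ** (C k - H ** J ** B k))"]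
      unfolding power2_norm_eq_inner inner_matrix_eq_trace tV
      unfolding V_def R by (simp add: matrix_mul_assoc T)
    then show ?thesis
      by (simp add: schur_d2_def Let_def q2 matrix_mult_scaleR_right matrix_mult.sum_right trace_scaleR
          trace_minus matrix_mult.minus_right trace_sum flip: J_def)
  qed
  have bar2: "bar_d2 Y B H C = a\<^sup>2 + h\<^sup>2 + 2 * q\<^sup>2"
    unfolding bar_d2_def Let_def using XX NN KG2 by (simp flip: J_def K_def G1_def X_def N_def)
  then show "0 \<le> bar_d2 Y B H C" by simp
  have cube: "\<bar>trace (S ** S ** S)\<bar> \<le> norm S ^ 3" for S :: "real^'l^'l"
  proof -
    have "\<bar>trace (S ** S ** S)\<bar> \<le> norm (S ** S) * norm S"
      by (rule abs_trace_mult_le)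
    also have "\<dots> \<le> (norm S * norm S) * norm S"
      by (intro mult_right_mono norm_matrix_mult_le) simp
    finally show ?thesis by (simp add: power3_eq_cube)
  qed
  have sandwich: "\<bar>trace (S ** transpose W ** W)\<bar> \<le> norm S * (norm W)\<^sup>2" for S W :: "real^'l^'l"
  proof -
    have "\<bar>trace (S ** transpose W ** W)\<bar> \<le> norm (S ** transpose W) * norm W"
      by (rule abs_trace_mult_le)
    also have "\<dots> \<le> (norm S * norm W) * norm W"
      using norm_matrix_mult_le[of S "transpose W"] by (simp add: norm_transpose mult_right_mono)
    finally show ?thesis by (simp add: power2_eq_square mult.assoc)
  qed
  have XXX: "\<bar>trace (X ** X ** X)\<bar> \<le> a ^ 3"
  proof -
    have "trace (X ** X ** X) = trace (A ** A ** A)"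
      using trace_mul_sym[of R "transpose R ** G1 ** R ** transpose R ** G1 ** R ** transpose R ** G1"]
      by (simp add: X_def R A_def matrix_mul_assoc)
    then show ?thesis
      using cube[of A] by (simp add: a_def)
  qed
  have NNN: "\<bar>trace (N ** N ** N)\<bar> \<le> h ^ 3"
  proof -
    have "trace (N ** N ** N) = trace (M ** M ** M)"
      using trace_mul_sym[of T "transpose T ** H ** T ** transpose T ** H ** T ** transpose T ** H"]
      by (simp add: N_def T M_def matrix_mul_assoc)
    then show ?thesis
      using cube[of M] by (simp add: h_def)
  qed
  have XKG2: "\<bar>trace (X ** K ** schur_d2 Y B H C)\<bar> \<le> 2 * (a * q\<^sup>2)"
  proof -
    have eq: "trace (X ** K ** ((C k - B k ** J ** H) ** J ** (C k - H ** J ** B k))) =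
        trace (A ** transpose (V k) ** V k)" for k
      using trace_mul_sym[of R "transpose R ** G1 ** R ** transpose R **
          ((C k - B k ** J ** H) ** J ** (C k - H ** J ** B k))"]
      unfolding tV unfolding V_def R A_def X_def by (simp add: matrix_mul_assoc T)
    have "trace (X ** K ** schur_d2 Y B H C) = - 2 * (\<Sum>k\<in>UNIV. trace (A ** transpose (V k) ** V k))"
      unfolding eq[symmetric]
      by (simp add: schur_d2_def Let_def matrix_mult_scaleR_right matrix_mult.sum_right trace_scaleR
          trace_minus matrix_mult.minus_right trace_sum flip: J_def)
    then have "\<bar>trace (X ** K ** schur_d2 Y B H C)\<bar> = 2 * \<bar>\<Sum>k\<in>UNIV. trace (A ** transpose (V k) ** V k)\<bar>"
      by simp
    also have "\<dots> \<le> 2 * (\<Sum>k\<in>UNIV. a * (norm (V k))\<^sup>2)"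
      unfolding a_def by (intro mult_left_mono order.trans[OF sum_abs] sum_mono sandwich) simp
    finally show ?thesis
      by (simp add: q2 sum_distrib_left)
  qed
  have KG3: "\<bar>trace (K ** schur_d3 Y B H C)\<bar> \<le> 6 * (h * q\<^sup>2)"
  proof -
    \<comment> \<open>Cyclicity brings \<open>M\<close> to the front and leaves \<open>V k\<close>
      before its transpose; the double transpose puts this into the shape of \<open>sandwich\<close>
      with \<open>W = transpose (V k)\<close>.\<close>
    have eq: "trace (K ** ((C k - B k ** J ** H) ** J ** H ** J ** (C k - H ** J ** B k))) =
        trace (M ** transpose (transpose (V k)) ** transpose (V k))" for k
    proof -
      have "trace (K ** ((C k - B k ** J ** H) ** J ** H ** J ** (C k - H ** J ** B k))) =
          trace (transpose (V k) ** (M ** V k))"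
        using trace_mul_sym[of R "transpose R **
          ((C k - B k ** J ** H) ** J ** H ** J ** (C k - H ** J ** B k))"]
        unfolding tV unfolding V_def R M_def by (simp add: matrix_mul_assoc T)
      then show ?thesis
        by (simp add: trace_mul_sym[of "transpose (V k)"])
    qed
    have "trace (K ** schur_d3 Y B H C) =
        6 * (\<Sum>k\<in>UNIV. trace (M ** transpose (transpose (V k)) ** transpose (V k)))"
      unfolding eq[symmetric]
      by (simp add: schur_d3_def Let_def matrix_mult_scaleR_right matrix_mult.sum_right trace_scaleR
          trace_sum flip: J_def)
    then have "\<bar>trace (K ** schur_d3 Y B H C)\<bar> =
        6 * \<bar>\<Sum>k\<in>UNIV. trace (M ** transpose (transpose (V k)) ** transpose (V k))\<bar>"
      by (simp add: abs_mult)
    also have "\<dots> \<le> 6 * (\<Sum>k\<in>UNIV. h * (norm (transpose (V k)))\<^sup>2)"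
      unfolding h_def by (intro mult_left_mono order.trans[OF sum_abs] sum_mono sandwich) simp
    finally show ?thesis
      by (simp add: q2 sum_distrib_left norm_transpose)
  qed
  have "\<bar>bar_d3 Y B H C\<bar> \<le> 2 * a ^ 3 + 6 * (a * q\<^sup>2) + 6 * (h * q\<^sup>2) + 2 * h ^ 3"
    unfolding bar_d3_def Let_def J_def[symmetric] K_def[symmetric] G1_def[symmetric]
      X_def[symmetric] N_def[symmetric]
    using XXX NNN XKG2 KG3 by linarith
  also have "\<dots> = 2 * (a ^ 3 + h ^ 3 + 3 * (a + h) * q\<^sup>2)"
    by (simp add: algebra_simps)
  also have "\<dots> \<le> 2 * (bar_d2 Y B H C) powr (3/2)"
    unfolding bar2 using trace_cube_2x2_le[of a h q] by simp
  finally show "\<bar>bar_d3 Y B H C\<bar> \<le> 2 * (bar_d2 Y B H C) powr (3/2)" .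
qed

section \<open>The domain\<close>

lemma eventually_pos_def:
  fixes A :: "'a \<Rightarrow> real^'n^'n"
  assumes "(A \<longlongrightarrow> A0) F" "pos_def A0" "\<forall>\<^sub>F x in F. transpose (A x) = A x"
  shows "\<forall>\<^sub>F x in F. pos_def (A x)"
proof -
  obtain e where e: "e > 0" "\<And>B. transpose B = B \<Longrightarrow> dist B A0 < e \<Longrightarrow> pos_def B"
    using pos_def_ball[OF assms(2)] by blast
  have "\<forall>\<^sub>F x in F. dist (A x) A0 < e"
    using assms(1) e(1) by (rule tendstoD)
  with assms(3) show ?thesis
    by eventually_elim (rule e(2))
qed

text \<open>Each subtracted term has trace \<open>(norm (transpose T ** B k))\<^sup>2\<close>. The
  bound stays useful where \<open>Y\<close> approaches a singular matrix and its inverse blows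
  up.\<close>

lemma trace_schur_le:
  fixes Y :: "real^'l^'l"
  assumes "pos_def Y" "\<And>k. transpose (B k) = B k"
  shows "trace (schur Y B) \<le> trace Y"
proof -
  obtain T :: "real^'l^'l" where T: "matrix_inv Y = T ** transpose T"
    using pos_def_inverse_factor[OF assms(1)] .
  have "trace (B k ** matrix_inv Y ** B k) = (norm (transpose T ** B k))\<^sup>2" for k
    by (simp add: T power2_norm_eq_inner inner_matrix_eq_trace matrix_transpose_mul assms(2) matrix_mul_assoc)
  then show ?thesis
    by (simp add: schur_def trace_diff trace_sum sum_nonneg)
qed

text \<open>Collects the properties of \<open>\<Lambda>\<close> that the barrier argument uses; the
  positive definite value ensures that the domain is nonempty.\<close>

locale sym_pencil =
  fixes \<Lambda> :: "'v::euclidean_space \<Rightarrow> real^'l^'l"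
  assumes linear_pencil: "linear \<Lambda>"
    and transpose_pencil: "transpose (\<Lambda> v) = \<Lambda> v"
    and nondegenerate: "\<exists>e. pos_def (\<Lambda> e)"
begin

definition blocks :: "'v \<times> ('v^'k) \<Rightarrow> 'k::finite \<Rightarrow> real^'l^'l" where
  "blocks s k = \<Lambda> (snd s $ k)"

definition compl :: "'v \<times> ('v^'k::finite) \<Rightarrow> real^'l^'l" where
  "compl s = schur (\<Lambda> (fst s)) (blocks s)"

definition feasible :: "('v \<times> ('v^'k::finite)) set" where
  "feasible = {s. pos_def (\<Lambda> (fst s)) \<and> pos_def (compl s)}"

definition barrier :: "'v \<times> ('v^'k::finite) \<Rightarrow> real" where
  "barrier s = bar (\<Lambda> (fst s)) (blocks s)"

lemma barrier_eq: "barrier s = - ln (det (compl s)) - ln (det (\<Lambda> (fst s)))"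
  by (simp add: barrier_def bar_def compl_def)

lemma bounded_linear_pencil: "bounded_linear \<Lambda>"
  using linear_pencil by (simp add: linear_conv_bounded_linear)

lemma bounded_linear_fst_pencil: "bounded_linear (\<lambda>s :: 'v \<times> ('v^'k::finite). \<Lambda> (fst s))"
  by (rule bounded_linear_compose[OF bounded_linear_pencil bounded_linear_fst])

lemma bounded_linear_blocks: "bounded_linear (\<lambda>s :: 'v \<times> ('v^'k::finite). blocks s k)"
  unfolding blocks_def
  by (intro bounded_linear_compose[OF bounded_linear_pencil]
      bounded_linear_compose[OF bounded_linear_vec_nth] bounded_linear_snd)

lemma transpose_blocks: "transpose (blocks s k) = blocks s k"
  by (simp add: blocks_def transpose_pencil)

lemma transpose_compl:
  assumes "det (\<Lambda> (fst s)) \<noteq> 0"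
  shows "transpose (compl s) = compl s"
  using assms
  by (simp add: compl_def schur_def transpose_diff transpose_sum matrix_transpose_mul transpose_blocks transpose_pencil
      transpose_matrix_inv invertible_det_nz matrix_mul_assoc)

lemma tendsto_compl:
  assumes "(f \<longlongrightarrow> s) F" "det (\<Lambda> (fst s)) \<noteq> 0"
  shows "((\<lambda>x. compl (f x)) \<longlongrightarrow> compl s) F"
  unfolding compl_def schur_def
  by (intro tendsto_diff tendsto_sum matrix_mult.tendsto tendsto_matrix_inv
      bounded_linear.tendsto[OF bounded_linear_fst_pencil] bounded_linear.tendsto[OF bounded_linear_blocks] assms)

text \<open>The quadratic form of the block arrow matrix with diagonal blocks \<open>\<Lambda> s\<^sub>1\<close> and border
  \<open>- \<Lambda> s\<^sub>i\<close>, evaluated at the block vector \<open>(x, w)\<close>.\<close>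

definition arrow_form :: "'v \<times> ('v^'k::finite) \<Rightarrow> real^'l \<Rightarrow> ('k \<Rightarrow> real^'l) \<Rightarrow> real" where
  "arrow_form s x w = x \<bullet> (\<Lambda> (fst s) *v x) - 2 * (\<Sum>k\<in>UNIV. w k \<bullet> (blocks s k *v x))
     + (\<Sum>k\<in>UNIV. w k \<bullet> (\<Lambda> (fst s) *v w k))"

text \<open>Completing the square in each \<open>w k\<close>. When \<open>\<Lambda> (fst s)\<close>
  is positive definite, \<open>z\<close> is the minimizing \<open>w\<close> and the form of
  \<open>compl s\<close> is the minimum.\<close>

lemma arrow_form_eq:
  fixes s :: "'v \<times> ('v^'k::finite)" and x :: "real^'l"
  assumes "det (\<Lambda> (fst s)) \<noteq> 0"
  defines "z k \<equiv> matrix_inv (\<Lambda> (fst s)) *v (blocks s k *v x)"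
  shows "arrow_form s x w = x \<bullet> (compl s *v x) +
     (\<Sum>k\<in>UNIV. (w k - z k) \<bullet> (\<Lambda> (fst s) *v (w k - z k)))"
proof -
  let ?Y = "\<Lambda> (fst s)"
  have Yz: "?Y *v z k = blocks s k *v x" for k
    using assms(1) by (simp add: z_def matrix_vector_mul_assoc matrix_inv_mult invertible_det_nz matrix_mul_assoc)
  have "z k \<bullet> (?Y *v w k) = w k \<bullet> (blocks s k *v x)" for k
    using inner_transpose_matrix[of "z k" ?Y "w k"] by (simp add: transpose_pencil Yz inner_commute)
  moreover have "z k \<bullet> (blocks s k *v x) = x \<bullet> ((blocks s k ** matrix_inv ?Y ** blocks s k) *v x)" for k
    using inner_transpose_matrix[of x "blocks s k" "z k"]
    by (simp add: transpose_blocks inner_commute z_def matrix_vector_mul_assoc matrix_mul_assoc)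
  ultimately have "(w k - z k) \<bullet> (?Y *v (w k - z k)) = w k \<bullet> (?Y *v w k) - 2 * (w k \<bullet> (blocks s k *v x)) +
      x \<bullet> ((blocks s k ** matrix_inv ?Y ** blocks s k) *v x)" for k
    by (simp add: matrix_vector_mult_diff_distrib inner_diff_left inner_diff_right Yz)
  moreover have "(\<Sum>k\<in>UNIV. blocks s k ** matrix_inv ?Y ** blocks s k) *v x =
      (\<Sum>k\<in>UNIV. (blocks s k ** matrix_inv ?Y ** blocks s k) *v x)"
    by (induction rule: infinite_finite_induct) (simp_all add: matrix_vector_mult_add_rdistrib)
  ultimately show ?thesis
    by (simp add: arrow_form_def compl_def schur_def matrix_vector_mult_diff_rdistrib inner_diff_right
        inner_sum_right sum.distrib sum_subtractf sum_distrib_left)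
qed

lemma feasible_iff_arrow_form:
  fixes s :: "'v \<times> ('v^'k::finite)"
  shows "s \<in> feasible \<longleftrightarrow> (\<forall>x w. x \<noteq> 0 \<longrightarrow> 0 < arrow_form s x w)"
proof
  assume s: "s \<in> feasible"
  show "\<forall>x w. x \<noteq> 0 \<longrightarrow> 0 < arrow_form s x w"
  proof (intro allI impI)
    fix x :: "real^'l" and w :: "'k \<Rightarrow> real^'l" assume "x \<noteq> 0"
    have "0 \<le> y \<bullet> (\<Lambda> (fst s) *v y)" for y
      using s by (cases "y = 0") (auto simp: feasible_def pos_def_def less_imp_le)
    then show "0 < arrow_form s x w"
      using s \<open>x \<noteq> 0\<close> pos_def_det_nz[of "\<Lambda> (fst s)"]
      by (auto simp: arrow_form_eq feasible_def pos_def_def[of "compl s"] intro!: add_pos_nonneg sum_nonneg)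
  qed
next
  assume *: "\<forall>x w. x \<noteq> 0 \<longrightarrow> 0 < arrow_form s x w"
  \<comment> \<open>The choice \<open>w = 0\<close> isolates the first diagonal block.\<close>
  then have "0 < x \<bullet> (\<Lambda> (fst s) *v x)" if "x \<noteq> 0" for x
    using that[THEN *[rule_format, of x "\<lambda>_. 0"]] by (simp add: arrow_form_def)
  then have Y: "pos_def (\<Lambda> (fst s))"
    by (simp add: pos_def_def transpose_pencil)
  note nz = pos_def_det_nz[OF Y]
  \<comment> \<open>The minimizing \<open>w\<close> makes all squares vanish.\<close>
  have "0 < x \<bullet> (compl s *v x)" if "x \<noteq> 0" for x
    using that[THEN *[rule_format, of x "\<lambda>k. matrix_inv (\<Lambda> (fst s)) *v (blocks s k *v x)"]]
    by (simp add: arrow_form_eq nz)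
  then show "s \<in> feasible"
    using Y transpose_compl[OF nz] by (simp add: feasible_def pos_def_def[of "compl s"])
qed

text \<open>With \<open>feasible_iff_arrow_form\<close>, linearity in \<open>s\<close> for fixed
  \<open>x\<close> and \<open>w\<close> exhibits the domain as an intersection of open half-spaces;
  convexity and invariance under positive scaling follow.\<close>

lemma arrow_form_linear:
  "arrow_form (a *\<^sub>R s + b *\<^sub>R s') x w = a * arrow_form s x w + b * arrow_form s' x w"
proof -
  have 1: "\<Lambda> (fst (a *\<^sub>R s + b *\<^sub>R s')) = a *\<^sub>R \<Lambda> (fst s) + b *\<^sub>R \<Lambda> (fst s')"
    using linear_pencil by (simp add: linear_add linear_scale)
  have 2: "blocks (a *\<^sub>R s + b *\<^sub>R s') k = a *\<^sub>R blocks s k + b *\<^sub>R blocks s' k" for k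
    using linear_pencil by (simp add: blocks_def linear_add linear_scale)
  show ?thesis
    unfolding arrow_form_def 1 2
    by (simp add: matrix_vector_mult_add_rdistrib inner_add_right sum.distrib sum_distrib_left
        algebra_simps flip: scaleR_matrix_vector_assoc)
qed

lemma convex_feasible: "convex feasible"
proof (rule convexI)
  fix s s' :: "'v \<times> ('v^'k)" and a b :: real
  assume s: "s \<in> feasible" "s' \<in> feasible" and ab: "0 \<le> a" "0 \<le> b" "a + b = 1"
  \<comment> \<open>Strictness holds because \<open>a\<close> and \<open>b\<close> cannot both
    vanish.\<close>
  have "0 < a * p + b * q" if "0 < p" "0 < q" for p q
    using ab that by (smt (verit) mult_nonneg_nonneg mult_pos_pos)
  then show "a *\<^sub>R s + b *\<^sub>R s' \<in> feasible"
    using s by (simp add: feasible_iff_arrow_form arrow_form_linear)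
qed

lemma scaleR_feasible: "s \<in> feasible \<Longrightarrow> 0 < c \<Longrightarrow> c *\<^sub>R s \<in> feasible"
  using arrow_form_linear[of c s 0] by (simp add: feasible_iff_arrow_form)

text \<open>An infinite intersection of open half-spaces need not be open, so the argument uses
  stability of positive definiteness under symmetric perturbations. The first block comes first: its
  invertibility near \<open>s\<close> makes \<open>compl\<close> symmetric there.\<close>

lemma open_feasible: "open (feasible :: ('v \<times> ('v^'k::finite)) set)"
proof (subst open_subopen, intro ballI)
  fix s :: "'v \<times> ('v^'k)" assume s: "s \<in> feasible"
  have id: "((\<lambda>x. x) \<longlongrightarrow> s) (nhds s)"
    by (simp add: filterlim_ident)
  have Y: "pos_def (\<Lambda> (fst s))" and P: "pos_def (compl s)"
    using s by (simp_all add: feasible_def)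
  have evY: "\<forall>\<^sub>F y in nhds s. pos_def (\<Lambda> (fst y))"
    using bounded_linear.tendsto[OF bounded_linear_fst_pencil id] Y by (rule eventually_pos_def) (simp add: transpose_pencil)
  then have "\<forall>\<^sub>F y in nhds s. transpose (compl y) = compl y"
    by eventually_elim (rule transpose_compl[OF pos_def_det_nz])
  then have "\<forall>\<^sub>F y in nhds s. pos_def (compl y)"
    by (rule eventually_pos_def[OF tendsto_compl[OF id pos_def_det_nz[OF Y]] P])
  with evY have "\<forall>\<^sub>F y in nhds s. y \<in> feasible"
    by eventually_elim (simp add: feasible_def)
  then show "\<exists>T. open T \<and> s \<in> T \<and> T \<subseteq> feasible"
    by (auto simp: eventually_nhds)
qed

lemma feasible_nonempty: "feasible \<noteq> ({} :: ('v \<times> ('v^'k::finite)) set)"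
proof -
  obtain e where e: "pos_def (\<Lambda> e)"
    using nondegenerate by blast
  have "blocks (e, 0 :: ('v^'k)) k = 0" for k
    using linear_pencil by (simp add: blocks_def linear_0)
  then have "(e, 0 :: ('v^'k)) \<in> feasible"
    using e by (simp add: feasible_def compl_def schur_def)
  then show ?thesis by blast
qed

text \<open>Closing a convex set does not enlarge its interior, and the domain is already
  open.\<close>

lemma interior_closure_feasible: "interior (closure feasible) = feasible"
  by (simp add: convex_interior_closure[OF convex_feasible] interior_open[OF open_feasible])

lemma cone_closure_feasible: "cone (closure (feasible :: ('v \<times> ('v^'k::finite)) set))"
  unfolding cone_def
proof (intro ballI allI impI)
  fix s :: "'v \<times> ('v^'k)" and c :: real
  assume s: "s \<in> closure feasible" and "0 \<le> c"
  show "c *\<^sub>R s \<in> closure feasible"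
  proof (cases "c = 0")
    case False
    then have "(*\<^sub>R) c ` feasible \<subseteq> (feasible :: ('v \<times> ('v^'k)) set)"
      using scaleR_feasible \<open>0 \<le> c\<close> by (auto simp: less_eq_real_def)
    then have "closure ((*\<^sub>R) c ` feasible) \<subseteq> closure (feasible :: ('v \<times> ('v^'k)) set)"
      by (rule closure_mono)
    then show ?thesis
      using s by (auto simp: closure_scaleR[symmetric])
  next
    \<comment> \<open>Positive scaling does not reach the origin, which is instead the limit of
      \<open>s0\<close> scaled by \<open>1 / (n + 1)\<close>.\<close>
    case True
    obtain s0 :: "'v \<times> ('v^'k)" where s0: "s0 \<in> feasible"
      using feasible_nonempty by blast
    have "(\<lambda>n. inverse (real (Suc n)) *\<^sub>R s0) \<longlonglongrightarrow> 0 *\<^sub>R s0"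
      by (intro tendsto_scaleR LIMSEQ_inverse_real_of_nat tendsto_const)
    moreover have "inverse (real (Suc n)) *\<^sub>R s0 \<in> feasible" for n
      using scaleR_feasible[OF s0] by simp
    ultimately have "0 *\<^sub>R s0 \<in> closure feasible"
      unfolding closure_sequential by (intro exI[of _ "\<lambda>n. inverse (real (Suc n)) *\<^sub>R s0"]) blast
    then show ?thesis using True by simp
  qed
qed

section \<open>The barrier\<close>

lemma feasible_det_pos:
  assumes "s \<in> feasible"
  shows "det (\<Lambda> (fst s)) > 0" "det (compl s) > 0"
  using assms by (auto simp: feasible_def intro: pos_def_det_pos)

lemma C_diff_barrier: "C_diff n feasible (barrier :: 'v \<times> ('v^'k::finite) \<Rightarrow> real)"
proof -
  have entry: "C_diff n feasible (\<lambda>s. A s $ i $ j)" if "bounded_linear A"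
    for A :: "'v \<times> ('v^'k) \<Rightarrow> real^'l^'l" and i j
    by (intro C_diff_linear bounded_linear_compose[OF bounded_linear_vec_nth] that)
  have prod: "C_diff n feasible (\<lambda>s. (A s ** A' s) $ i $ j)"
    if "\<And>i j. C_diff n feasible (\<lambda>s. A s $ i $ j)" "\<And>i j. C_diff n feasible (\<lambda>s. A' s $ i $ j)"
    for A A' :: "'v \<times> ('v^'k) \<Rightarrow> real^'l^'l" and i j
    unfolding matrix_matrix_mult_def by (simp, intro C_diff_sum C_diff_mult that)
  have "C_diff n feasible (\<lambda>s :: 'v \<times> ('v^'k). compl s $ i $ j)" for i j
    unfolding compl_def schur_def
    by (simp add: sum_component, intro C_diff_diff C_diff_sum prod C_diff_matrix_inv open_feasible
        entry[OF bounded_linear_fst_pencil] entry[OF bounded_linear_blocks])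
      (use feasible_det_pos in force)
  then have "C_diff n feasible (\<lambda>s :: 'v \<times> ('v^'k). - ln (det (compl s)) - ln (det (\<Lambda> (fst s))))"
    by (intro C_diff_diff C_diff_minus C_diff_ln C_diff_det entry[OF bounded_linear_fst_pencil] feasible_det_pos)
  then show ?thesis
    by (simp add: barrier_eq[abs_def])
qed

section \<open>The barrier restricted to lines\<close>

context
  fixes s h :: "'v \<times> ('v^'k::finite)" and t :: real
  assumes feasible: "s + t *\<^sub>R h \<in> feasible"
begin

private lemma line_derivative:
  assumes "bounded_linear A"
  shows "((\<lambda>t. A (s + t *\<^sub>R h)) has_vector_derivative A h) (at t)"
  by (rule bounded_linear.has_vector_derivative[OF assms]) (auto intro!: derivative_eq_intros)

private lemmas line = line_derivative[OF bounded_linear_fst_pencil] line_derivative[OF bounded_linear_blocks]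
  feasible_det_pos[OF feasible, unfolded compl_def]

lemma barrier_derivative:
  "((\<lambda>t. barrier (s + t *\<^sub>R h)) has_real_derivative
     bar_d1 (\<Lambda> (fst (s + t *\<^sub>R h))) (blocks (s + t *\<^sub>R h)) (\<Lambda> (fst h)) (blocks h)) (at t)"
  unfolding barrier_def by (intro bar_derivative line)

lemma barrier_derivative2:
  "((\<lambda>t. bar_d1 (\<Lambda> (fst (s + t *\<^sub>R h))) (blocks (s + t *\<^sub>R h)) (\<Lambda> (fst h)) (blocks h)) has_real_derivative
     bar_d2 (\<Lambda> (fst (s + t *\<^sub>R h))) (blocks (s + t *\<^sub>R h)) (\<Lambda> (fst h)) (blocks h)) (at t)"
  by (intro bar_d1_derivative line)

lemma barrier_derivative3:
  "((\<lambda>t. bar_d2 (\<Lambda> (fst (s + t *\<^sub>R h))) (blocks (s + t *\<^sub>R h)) (\<Lambda> (fst h)) (blocks h)) has_real_derivative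
     bar_d3 (\<Lambda> (fst (s + t *\<^sub>R h))) (blocks (s + t *\<^sub>R h)) (\<Lambda> (fst h)) (blocks h)) (at t)"
  by (intro bar_d2_derivative line)

end

lemma convex_on_barrier: "convex_on feasible (barrier :: 'v \<times> ('v^'k::finite) \<Rightarrow> real)"
proof (rule convex_onI[OF _ convex_feasible])
  fix u :: real and s s' :: "'v \<times> ('v^'k)"
  assume u: "0 < u" "u < 1" and s: "s \<in> feasible" "s' \<in> feasible"
  define h where "h = s' - s"
  have line: "s + t *\<^sub>R h \<in> feasible" if "t \<in> {0..1}" for t
    using convexD[OF convex_feasible s, of "1 - t" t] that by (simp add: h_def algebra_simps)
  have "convex_on {0..1} (\<lambda>t. barrier (s + t *\<^sub>R h))"
  proof (rule f''_ge0_imp_convex)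
    fix t :: real assume "t \<in> {0..1}"
    then have d: "s + t *\<^sub>R h \<in> feasible" by (rule line)
    show "((\<lambda>t. barrier (s + t *\<^sub>R h)) has_real_derivative
      bar_d1 (\<Lambda> (fst (s + t *\<^sub>R h))) (blocks (s + t *\<^sub>R h)) (\<Lambda> (fst h)) (blocks h)) (at t)"
      by (rule barrier_derivative[OF d])
    show "((\<lambda>t. bar_d1 (\<Lambda> (fst (s + t *\<^sub>R h))) (blocks (s + t *\<^sub>R h)) (\<Lambda> (fst h)) (blocks h)) has_real_derivative
      bar_d2 (\<Lambda> (fst (s + t *\<^sub>R h))) (blocks (s + t *\<^sub>R h)) (\<Lambda> (fst h)) (blocks h)) (at t)"
      by (rule barrier_derivative2[OF d])
    show "0 \<le> bar_d2 (\<Lambda> (fst (s + t *\<^sub>R h))) (blocks (s + t *\<^sub>R h)) (\<Lambda> (fst h)) (blocks h)"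
      using d by (intro bar_d2_nonneg) (simp_all add: feasible_def compl_def transpose_pencil transpose_blocks)
  qed simp
  from convex_onD[OF this, of u 0 1] u
  have "barrier (s + u *\<^sub>R h) \<le> (1 - u) * barrier s + u * barrier (s + h)"
    by simp
  then show "barrier ((1 - u) *\<^sub>R s + u *\<^sub>R s') \<le> (1 - u) * barrier s + u * barrier s'"
    by (simp add: h_def algebra_simps)
qed

text \<open>Identifies an abstract Frechet derivative, evaluated at \<open>h\<close>, with a formula
  computed along the line in direction \<open>h\<close>: the chain rule makes both the derivative of
  the same real function.\<close>

lemma directional_derivative_unique:
  fixes D :: "'v \<times> ('v^'k::finite) \<Rightarrow> real"
  assumes "s \<in> feasible" "(D has_derivative D') (at s)" "\<And>y. y \<in> feasible \<Longrightarrow> D y = g y"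
    and "((\<lambda>t. g (s + t *\<^sub>R h)) has_real_derivative g') (at 0)"
  shows "D' h = g'"
proof -
  have "(g has_derivative D') (at s)"
    using assms(1-3) open_feasible by (blast intro: has_derivative_transform_within_open)
  moreover have "((\<lambda>t :: real. s + t *\<^sub>R h) has_derivative (\<lambda>t. t *\<^sub>R h)) (at 0)"
    by (auto intro!: derivative_eq_intros)
  ultimately have "((\<lambda>t. g (s + t *\<^sub>R h)) has_derivative (\<lambda>t. D' (t *\<^sub>R h))) (at 0)"
    using diff_chain_at[of "\<lambda>t :: real. s + t *\<^sub>R h" "\<lambda>t. t *\<^sub>R h" 0 g D'] by (simp add: o_def)
  moreover have "D' (t *\<^sub>R h) = D' h * t" for t
    using linear_scale[OF has_derivative_linear[OF assms(2)], of t h] by simp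
  ultimately have "((\<lambda>t. g (s + t *\<^sub>R h)) has_real_derivative D' h) (at 0)"
    by (simp add: has_field_derivative_def)
  then show ?thesis
    using assms(4) by (rule DERIV_unique)
qed

text \<open>Smoothness supplies the three derivatives abstractly. Differentiating repeatedly along
  the same \<open>h\<close> identifies their diagonal values with \<open>bar_d1\<close>,
  \<open>bar_d2\<close> and \<open>bar_d3\<close>, to which the matrix inequality applies.\<close>

lemma barrier_self_concordant:
  obtains D1 :: "'v \<times> ('v^'k::finite) \<Rightarrow> ('v \<times> ('v^'k)) \<Rightarrow>\<^sub>L real"
    and D2 :: "'v \<times> ('v^'k) \<Rightarrow> ('v \<times> ('v^'k)) \<Rightarrow>\<^sub>L ('v \<times> ('v^'k)) \<Rightarrow>\<^sub>L real"
    and D3 :: "'v \<times> ('v^'k) \<Rightarrow> ('v \<times> ('v^'k)) \<Rightarrow>\<^sub>L ('v \<times> ('v^'k)) \<Rightarrow>\<^sub>L ('v \<times> ('v^'k)) \<Rightarrow>\<^sub>L real"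
  where "\<And>s. s \<in> feasible \<Longrightarrow> (barrier has_derivative blinfun_apply (D1 s)) (at s)"
    and "\<And>s. s \<in> feasible \<Longrightarrow> (D1 has_derivative blinfun_apply (D2 s)) (at s)"
    and "\<And>s. s \<in> feasible \<Longrightarrow> (D2 has_derivative blinfun_apply (D3 s)) (at s)"
    and "continuous_on feasible D3"
    and "\<And>s h. s \<in> feasible \<Longrightarrow> \<bar>D3 s h h h\<bar> \<le> 2 * (D2 s h h) powr (3/2)"
proof -
  obtain D1 D2 D3 where
    D1: "\<And>s. s \<in> feasible \<Longrightarrow> ((barrier :: 'v \<times> ('v^'k) \<Rightarrow> real) has_derivative blinfun_apply (D1 s)) (at s)" and
    D2: "\<And>s. s \<in> feasible \<Longrightarrow> (D1 has_derivative blinfun_apply (D2 s)) (at s)" and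
    D3: "\<And>s. s \<in> feasible \<Longrightarrow> (D2 has_derivative blinfun_apply (D3 s)) (at s)" and
    cont: "continuous_on feasible D3"
    using C_diff_3_blinfun_derivatives[OF C_diff_barrier] by blast
  have zero: "s + 0 *\<^sub>R h \<in> feasible" if "s \<in> feasible" for s h :: "'v \<times> ('v^'k)"
    using that by simp
  have eq1: "D1 s h = bar_d1 (\<Lambda> (fst s)) (blocks s) (\<Lambda> (fst h)) (blocks h)" if "s \<in> feasible" for s h
    using directional_derivative_unique[OF that D1[OF that] refl barrier_derivative[OF zero[OF that]]]
    by simp
  have eq2: "D2 s h h = bar_d2 (\<Lambda> (fst s)) (blocks s) (\<Lambda> (fst h)) (blocks h)" if "s \<in> feasible" for s h
  proof -
    have "((\<lambda>s. D1 s h) has_derivative (\<lambda>y. D2 s y h)) (at s)"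
      using D2[OF that] by (auto intro!: derivative_eq_intros)
    from directional_derivative_unique[OF that this eq1 barrier_derivative2[OF zero[OF that]]]
    show ?thesis by simp
  qed
  have eq3: "D3 s h h h = bar_d3 (\<Lambda> (fst s)) (blocks s) (\<Lambda> (fst h)) (blocks h)" if "s \<in> feasible" for s h
  proof -
    have "((\<lambda>s. D2 s h h) has_derivative (\<lambda>y. D3 s y h h)) (at s)"
      using D3[OF that] by (auto intro!: derivative_eq_intros)
    from directional_derivative_unique[OF that this eq2 barrier_derivative3[OF zero[OF that]]]
    show ?thesis by simp
  qed
  have "\<bar>D3 s h h h\<bar> \<le> 2 * (D2 s h h) powr (3/2)" if "s \<in> feasible" for s h
    unfolding eq2[OF that] eq3[OF that]
    using that by (intro bar_d3_le) (simp_all add: feasible_def compl_def transpose_pencil transpose_blocks)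
  then show thesis
    using that[of D1 D2 D3] D1 D2 D3 cont by blast
qed

text \<open>The barrier is minus the logarithm of the product of two positive determinants, so it
  suffices that this product tends to 0.\<close>

lemma barrier_at_boundary:
  fixes X :: "nat \<Rightarrow> 'v \<times> ('v^'k::finite)"
  assumes X: "\<And>j. X j \<in> feasible" and lim: "X \<longlonglongrightarrow> s" and s: "s \<notin> feasible"
  shows "filterlim (\<lambda>j. barrier (X j)) at_top sequentially"
proof -
  let ?Y = "\<lambda>j. \<Lambda> (fst (X j))"
  have limY: "?Y \<longlonglongrightarrow> \<Lambda> (fst s)"
    using bounded_linear.tendsto[OF bounded_linear_fst_pencil lim] .
  have psd_lim: "0 \<le> x \<bullet> (A *v x)" if "A' \<longlonglongrightarrow> A" "\<And>j. pos_def (A' j)"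
    for A :: "real^'l^'l" and A' x
  proof (rule LIMSEQ_le_const)
    show "(\<lambda>j. x \<bullet> (A' j *v x)) \<longlonglongrightarrow> x \<bullet> (A *v x)"
      unfolding matrix_vector_mult_def
      by (intro tendsto_inner tendsto_const vec_tendstoI) (auto intro!: tendsto_intros that(1))
    show "\<exists>N. \<forall>j\<ge>N. 0 \<le> x \<bullet> (A' j *v x)"
      using that(2) by (cases "x = 0") (auto simp: pos_def_def less_imp_le)
  qed
  have prod0: "(\<lambda>j. det (compl (X j)) * det (?Y j)) \<longlonglongrightarrow> 0"
  proof (cases "det (\<Lambda> (fst s)) = 0")
    \<comment> \<open>Here \<open>compl (X j)\<close> may fail to converge, but its norm is bounded
      by the convergent traces of the first block. Its determinant stays bounded while the other
      factor tends to 0.\<close>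
    case True
    have "Bseq (\<lambda>j. trace (?Y j))"
      using bounded_linear.tendsto[OF bounded_linear_trace limY] convergent_imp_Bseq convergent_def by blast
    then obtain c where c: "\<And>j. \<bar>trace (?Y j)\<bar> \<le> c"
      by (auto simp: Bseq_def)
    have "norm (compl (X j)) \<le> c" for j
    proof -
      have "norm (compl (X j)) \<le> trace (compl (X j))"
        using X[of j] by (simp add: feasible_def pos_def_norm_le_trace)
      also have "\<dots> \<le> trace (?Y j)"
        using X[of j] unfolding compl_def by (intro trace_schur_le transpose_blocks) (simp add: feasible_def)
      finally show ?thesis using c[of j] by linarith
    qed
    moreover have "bounded (det ` cball (0 :: real^'l^'l) c)"
      by (intro compact_imp_bounded compact_continuous_image compact_cball)
        (auto simp: continuous_on_def intro!: tendsto_det tendsto_ident_at)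
    then obtain b where "\<forall>A \<in> cball (0 :: real^'l^'l) c. \<bar>det A\<bar> \<le> b"
      by (auto simp: bounded_iff)
    ultimately have "\<bar>det (compl (X j))\<bar> \<le> b" for j
      by simp
    then have bound: "norm (det (compl (X j)) * det (?Y j)) \<le> b * \<bar>det (?Y j)\<bar>" for j
      by (simp add: abs_mult mult_right_mono)
    have "(\<lambda>j. b * \<bar>det (?Y j)\<bar>) \<longlonglongrightarrow> b * \<bar>det (\<Lambda> (fst s))\<bar>"
      by (intro tendsto_intros tendsto_det limY)
    then have "(\<lambda>j. b * \<bar>det (?Y j)\<bar>) \<longlonglongrightarrow> 0"
      unfolding True by simp
    then show ?thesis
      by (rule Lim_null_comparison[OF always_eventually[OF allI[OF bound]]])
  next
    \<comment> \<open>Now \<open>compl (X j)\<close> converges and both limits are semidefinite. The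
      first block stays positive definite, so \<open>s\<close> can only lie outside the domain
      because \<open>compl s\<close> is singular.\<close>
    case False
    have limP: "(\<lambda>j. compl (X j)) \<longlonglongrightarrow> compl s"
      by (rule tendsto_compl[OF lim False])
    have "pos_def (\<Lambda> (fst s))"
      using psd_lim[OF limY] X False by (simp add: pos_def_iff_semidefinite_det transpose_pencil feasible_def)
    then have "\<not> pos_def (compl s)"
      using s by (simp add: feasible_def)
    then have "det (compl s) = 0"
      using psd_lim[OF limP] X transpose_compl[OF False] by (simp add: pos_def_iff_semidefinite_det feasible_def)
    then show ?thesis
      using tendsto_mult[OF tendsto_det[OF limP] tendsto_det[OF limY]] by simp
  qed
  have "filterlim (\<lambda>j. det (compl (X j)) * det (?Y j)) (at_right 0) sequentially"
    using prod0 feasible_det_pos[OF X] by (intro tendsto_imp_filterlim_at_right) auto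
  then have "filterlim (\<lambda>j. ln (det (compl (X j)) * det (?Y j))) at_bot sequentially"
    by (rule filterlim_compose[OF ln_at_0])
  moreover have "barrier (X j) = - ln (det (compl (X j)) * det (?Y j))" for j
    using feasible_det_pos[OF X[of j]] by (simp add: barrier_eq ln_mult)
  ultimately show ?thesis
    by (simp add: filterlim_uminus_at_top)
qed

text \<open>Both matrices are homogeneous of degree one in \<open>s\<close>, the inverse having
  degree minus one; each determinant contributes a factor \<open>c ^ CARD('l)\<close>, whence the
  2.\<close>

lemma barrier_scaleR:
  fixes s :: "'v \<times> ('v^'k::finite)"
  assumes "s \<in> feasible" "0 < c"
  shows "barrier (c *\<^sub>R s) = barrier s - 2 * real CARD('l) * ln c"
proof -
  have Y: "\<Lambda> (fst (c *\<^sub>R s)) = c *\<^sub>R \<Lambda> (fst s)"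
    using linear_pencil by (simp add: linear_scale)
  have B: "blocks (c *\<^sub>R s) k = c *\<^sub>R blocks s k" for k
    using linear_pencil by (simp add: blocks_def linear_scale)
  have "matrix_inv (c *\<^sub>R \<Lambda> (fst s)) = inverse c *\<^sub>R matrix_inv (\<Lambda> (fst s))"
    using assms feasible_det_pos(1)[OF assms(1)]
    by (intro matrix_inv_unique)
      (simp add: matrix_mult_scaleR_left matrix_mult_scaleR_right matrix_inv_mult invertible_det_nz)
  then have "compl (c *\<^sub>R s) = c *\<^sub>R compl s"
    using assms(2) unfolding compl_def schur_def Y B
    by (simp add: matrix_mult_scaleR_left matrix_mult_scaleR_right scaleR_diff_right scaleR_sum_right)
  then show ?thesis
    using assms(2) feasible_det_pos[OF assms(1)]
    by (simp add: barrier_eq Y[simplified] det_scaleR ln_mult ln_realpow)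
qed

theorem LHSCB_barrier:
  "LHSCB (closure feasible) (barrier :: 'v \<times> ('v^'k::finite) \<Rightarrow> real) (2 * real CARD('l))"
  unfolding LHSCB_def interior_closure_feasible
proof (intro conjI)
  show "closed (closure feasible)" by simp
  show "convex (closure feasible)" by (rule convex_closure[OF convex_feasible])
  show "cone (closure feasible)" by (rule cone_closure_feasible)
  show "feasible \<noteq> {}" by (rule feasible_nonempty)
  show "convex_on feasible barrier" by (rule convex_on_barrier)
  show "\<exists>(D1 :: 'v \<times> ('v^'k) \<Rightarrow> ('v \<times> ('v^'k)) \<Rightarrow>\<^sub>L real) D2 D3.
        (\<forall>x\<in>feasible. (barrier has_derivative blinfun_apply (D1 x)) (at x) \<and>
           (D1 has_derivative blinfun_apply (D2 x)) (at x) \<and>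
           (D2 has_derivative blinfun_apply (D3 x)) (at x)) \<and>
        continuous_on feasible D3 \<and>
        (\<forall>x\<in>feasible. \<forall>h. \<bar>D3 x h h h\<bar> \<le> 2 * (D2 x h h) powr (3/2))"
    using barrier_self_concordant by metis
  show "\<forall>X x. (\<forall>j. X j \<in> feasible) \<longrightarrow> X \<longlonglongrightarrow> x \<longrightarrow> x \<in> frontier (closure feasible) \<longrightarrow>
         filterlim (\<lambda>j. barrier (X j)) at_top sequentially"
    using barrier_at_boundary by (auto simp: frontier_def interior_closure_feasible)
  show "\<forall>x\<in>feasible. \<forall>c>0. barrier (c *\<^sub>R x) = barrier x - 2 * real CARD('l) * ln c"
    using barrier_scaleR by blast
qed

end

section \<open>Polynomial interpolation\<close>

lemma finite_multi_indices: "finite (multi_indices k :: ('n::finite \<Rightarrow> nat) set)"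
proof (rule finite_subset)
  show "multi_indices k \<subseteq> (PiE UNIV (\<lambda>_. {..k}) :: ('n \<Rightarrow> nat) set)"
  proof
    fix \<alpha> :: "'n \<Rightarrow> nat" assume "\<alpha> \<in> multi_indices k"
    then have "\<alpha> i \<le> k" for i
      using member_le_sum[of i UNIV \<alpha>] by (simp add: multi_indices_def)
    then show "\<alpha> \<in> PiE UNIV (\<lambda>_. {..k})" by auto
  qed
qed (simp add: finite_PiE)

lemma poly_funs_mono:
  assumes "k \<le> m"
  shows "poly_funs k \<subseteq> (poly_funs m :: (real^'n::finite \<Rightarrow> real) set)"
proof
  fix f :: "real^'n \<Rightarrow> real" assume "f \<in> poly_funs k"
  then obtain c where c: "f = (\<lambda>x. \<Sum>\<alpha>\<in>multi_indices k. c \<alpha> * monomial \<alpha> x)"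
    by (auto simp: poly_funs_def)
  \<comment> \<open>The coefficients are padded with zeros on the additional multi-indices.\<close>
  define c' where "c' \<alpha> = (if \<alpha> \<in> multi_indices k then c \<alpha> else 0)" for \<alpha>
  have "f = (\<lambda>x. \<Sum>\<alpha>\<in>multi_indices m. c' \<alpha> * monomial \<alpha> x)"
    unfolding c using assms
    by (intro ext sum.mono_neutral_cong_left finite_multi_indices) (auto simp: multi_indices_def c'_def)
  then show "f \<in> poly_funs m"
    unfolding poly_funs_def by (intro CollectI exI[of _ c'])
qed

lemma poly_funs_sum:
  assumes "\<And>l. p l \<in> poly_funs k"
  shows "(\<lambda>x. \<Sum>l\<in>(UNIV :: 'l::finite set). a l * p l x) \<in> poly_funs k"
proof -
  have "\<forall>l. \<exists>c. p l = (\<lambda>x. \<Sum>\<alpha>\<in>multi_indices k. c \<alpha> * monomial \<alpha> x)"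
    using assms by (simp add: poly_funs_def)
  then obtain c where c: "\<And>l. p l = (\<lambda>x. \<Sum>\<alpha>\<in>multi_indices k. c l \<alpha> * monomial \<alpha> x)"
    by metis
  have "(\<Sum>l\<in>UNIV. a l * p l x) = (\<Sum>\<alpha>\<in>multi_indices k. (\<Sum>l\<in>UNIV. a l * c l \<alpha>) * monomial \<alpha> x)" for x
    unfolding c sum_distrib_left sum_distrib_right by (subst sum.swap) (simp add: mult.assoc)
  then show ?thesis
    unfolding poly_funs_def by (intro CollectI exI[of _ "\<lambda>\<alpha>. \<Sum>l\<in>UNIV. a l * c l \<alpha>"]) auto
qed

section \<open>The map \<open>Lam\<close> as a symmetric pencil\<close>

lemma linear_Lam: "linear (Lam p t)"
  by (rule linearI)
    (simp_all add: Lam_def vec_eq_iff distrib_left distrib_right sum.distrib sum_distrib_left mult_ac)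

lemma transpose_Lam: "transpose (Lam p t s) = Lam p t s"
  by (simp add: Lam_def transpose_def vec_eq_iff mult_ac)

text \<open>The inner sum is the value at \<open>t u\<close> of the polynomial with coordinates
  \<open>x\<close>, so the quadratic form is a weighted sum of values of its square.\<close>

lemma inner_Lam: "x \<bullet> (Lam p t s *v x) = (\<Sum>u\<in>UNIV. s $ u * (\<Sum>l\<in>UNIV. x $ l * p l (t u))\<^sup>2)"
proof -
  have "x \<bullet> (Lam p t s *v x) =
      (\<Sum>i\<in>UNIV. \<Sum>j\<in>UNIV. \<Sum>u\<in>UNIV. s $ u * ((x $ i * p i (t u)) * (x $ j * p j (t u))))"
    by (simp add: inner_vec_def matrix_vector_mult_def Lam_def sum_distrib_left sum_distrib_right mult_ac)
  also have "\<dots> = (\<Sum>u\<in>UNIV. \<Sum>i\<in>UNIV. \<Sum>j\<in>UNIV. s $ u * ((x $ i * p i (t u)) * (x $ j * p j (t u))))"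
    by (subst (2) sum.swap, subst sum.swap) simp
  finally show ?thesis
    by (simp only: power2_eq_square sum_product) (simp add: sum_distrib_left)
qed

text \<open>The vector \<open>1\<close> puts weight one on every point, so the form is the sum of
  squares of \<open>f (t u)\<close>. If it vanishes, unisolvence for degree \<open>2 * d\<close>
  gives \<open>f = 0\<close>, and uniqueness of coordinates gives \<open>x = 0\<close>.\<close>

lemma pos_def_Lam_one:
  fixes t :: "'u::finite \<Rightarrow> real^'n::finite" and p :: "'l::finite \<Rightarrow> (real^'n \<Rightarrow> real)"
  assumes "unisolvent t (2 * d)" "is_basis_of p d"
  shows "pos_def (Lam p t 1)"
  unfolding pos_def_def
proof (intro conjI allI impI transpose_Lam)
  fix x :: "real^'l" assume "x \<noteq> 0"
  define f where "f y = (\<Sum>l\<in>UNIV. x $ l * p l y)" for y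
  have basis: "\<And>l. p l \<in> poly_funs d" "\<And>g. g \<in> poly_funs d \<Longrightarrow> \<exists>!c. g = (\<lambda>x. \<Sum>l\<in>UNIV. c l * p l x)"
    using assms(2) by (auto simp: is_basis_of_def)
  have f: "f \<in> poly_funs d"
    unfolding f_def[abs_def] by (rule poly_funs_sum) (rule basis(1))
  have unique: "c = c'" if "f = (\<lambda>y. \<Sum>l\<in>UNIV. c l * p l y)" "f = (\<lambda>y. \<Sum>l\<in>UNIV. c' l * p l y)" for c c'
    using basis(2)[OF f] that by blast
  have "f \<noteq> (\<lambda>_. 0)"
  proof
    assume "f = (\<lambda>_. 0)"
    \<comment> \<open>Zero coordinates give a second representation of \<open>f\<close>, written
      with \<open>(\<lambda>_. 0) l\<close> to match the shape of \<open>unique\<close>.\<close>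
    then have "f = (\<lambda>y. \<Sum>l\<in>UNIV. (\<lambda>_. 0) l * p l y)"
      by simp
    moreover have "f = (\<lambda>y. \<Sum>l\<in>UNIV. x $ l * p l y)"
      by (simp add: f_def[abs_def])
    ultimately have "($) x = (\<lambda>_. 0)"
      by (intro unique)
    then show False
      using \<open>x \<noteq> 0\<close> by (metis vec_eq_iff zero_index)
  qed
  moreover have "f \<in> poly_funs (2 * d)"
    using f poly_funs_mono[of d "2 * d"] by auto
  ultimately obtain u where "f (t u) \<noteq> 0"
    using assms(1) unfolding unisolvent_def by blast
  then have "0 < (\<Sum>u\<in>UNIV. (f (t u))\<^sup>2)"
    by (intro sum_pos2[of _ u]) auto
  then show "0 < x \<bullet> (Lam p t 1 *v x)"
    by (simp add: inner_Lam f_def)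
qed

theorem theorem1:
  fixes d :: nat
    and t :: "'u::finite \<Rightarrow> real^'n::finite"
    and p :: "'l::finite \<Rightarrow> (real^'n \<Rightarrow> real)"
    and S :: "((real^'u) \<times> (real^'u^'k::finite)) set"
    and F :: "(real^'u) \<times> (real^'u^'k) \<Rightarrow> real"
  assumes "d \<ge> 1"
    and "CARD('l) = (CARD('n) + d) choose CARD('n)"
    and "CARD('u) = (CARD('n) + 2 * d) choose CARD('n)"
    and "unisolvent t (2 * d)"
    and "is_basis_of p d"
    and "S = {s. pos_def (Lam p t (fst s)) \<and> pos_def (Pi_map p t s)}"
    and "F = (\<lambda>s. - ln (det (Pi_map p t s)) - ln (det (Lam p t (fst s))))"
  shows "interior (closure S) = S \<and> LHSCB (closure S) F (2 * real CARD('l))"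
proof -
  \<comment> \<open>The all-ones vector witnesses nondegeneracy; it remains to match
    \<open>compl\<close> and \<open>barrier\<close> with \<open>Pi_map\<close> and
    \<open>F\<close>.\<close>
  interpret sym_pencil "Lam p t"
    using pos_def_Lam_one[OF assms(4,5)] by (intro sym_pencil.intro linear_Lam transpose_Lam exI)
  have Pi: "compl s = Pi_map p t s" for s :: "(real^'u) \<times> (real^'u^'k)"
    by (simp add: compl_def schur_def Pi_map_def blocks_def)
  have "S = feasible"
    by (simp add: assms(6) feasible_def Pi)
  moreover have "F = barrier"
    by (simp add: assms(7) barrier_eq[abs_def] Pi)
  ultimately show ?thesis
    using interior_closure_feasible LHSCB_barrier by simp
qed

end
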